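(* Let $\mathscr{G}\in\mathcal{RH}_\infty^{m\times m\times p}$ be frequency-wise quasi-sectorial and let $\mathscr{H}\in\mathcal{RH}_\infty^{m\times m\times p}$ be frequency-wise semi-sectorial, and assume that for every $\omega\in\mathbb{R}$ the numerical ranges $W(\mathscr{G}(j\omega))$ and $W(\mathscr{H}(j\omega))$ avoid the negative real axis. Then the feedback system $\mathscr{G}\,\widetilde{\#}\,\mathscr{H}$ is stable if $$\overline{\phi}(\mathscr{G}(j\omega))+\overline{\phi}(\mathscr{H}(j\omega))<\pi\quad\text{and}\quad \underline{\phi}(\mathscr{G}(j\omega))+\underline{\phi}(\mathscr{H}(j\omega))>-\pi$$ hold for all $\omega\in[0,\infty]$.
   Context: T-product: for a third-order tensor $\mathscr{A}\in\mathbb{C}^{m\times n\times p}$ with frontal slices $A^{(1)},\dots,A^{(p)}$, $\operatorname{bcirc}(\mathscr{A})\in\mathbb{C}^{mp\times np}$ is the block-circulant matrix whose first block column is $A^{(1)},\dots,A^{(p)}$, $\operatorname{unfold}(\mathscr{A})$ is that first block column, $\operatorname{fold}$ is its inverse, and $\mathscr{A}*\mathscr{B}=\operatorname{fold}(\operatorname{bcirc}(\mathscr{A})\operatorname{unfold}(\mathscr{B}))$. $\operatorname{bcirc}$ is linear, injective and multiplicative; the T-inverse satisfies $\operatorname{bcirc}(\mathscr{A}^{-1})=\operatorname{bcirc}(\mathscr{A})^{-1}$. $\mathscr{I}$ denotes the identity tensor in $\mathbb{R}^{m\times m\times p}$, i.e. $\operatorname{bcirc}(\mathscr{I})=I_{mp}$.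 Systems: $\mathcal{RH}_\infty^{k\times k}$ is the set of real-rational proper stable $k\times k$ transfer matrices, and $\mathscr{G}\in\mathcal{RH}_\infty^{m\times m\times p}$ means that $\mathscr{G}$ is an $m\times m\times p$ tensor-valued function of $s$ with $\operatorname{bcirc}(\mathscr{G})\in\mathcal{RH}_\infty^{mp\times mp}$. Here $j=\sqrt{-1}$ and $\mathscr{G}(j\infty)$ is the limit as $\omega\to\infty$. Feedback: the feedback interconnection is stable if the tensor $$\mathscr{G}\,\widetilde{\#}\,\mathscr{H}=\begin{bmatrix}(\mathscr{I}+\mathscr{H}*\mathscr{G})^{-1}&(\mathscr{I}+\mathscr{H}*\mathscr{G})^{-1}*\mathscr{H}\\ \mathscr{G}*(\mathscr{I}+\mathscr{H}*\mathscr{G})^{-1}&\mathscr{G}*(\mathscr{I}+\mathscr{H}*\mathscr{G})^{-1}*\mathscr{H}\end{bmatrix}$$ (blocks arranged frontal slice by frontal slice) exists and belongs to $\mathcal{RH}_\infty^{2m\times 2m\times p}$. Phases: the numerical range $W(\mathscr{A})$ of $\mathscr{A}\in\mathbb{C}^{m\times m\times p}$ equals $\{x^H\operatorname{bcirc}(\mathscr{A})x: x\in\mathbb{C}^{mp},\|x\|=1\}$; $\mathscr{A}$ is sectorial if $0\notin W(\mathscr{A})$. For sectorial $\mathscr{A}$, $\operatorname{bcirc}(\mathscr{A})=T^HDT$ with $T$ nonsingular and $D$ diagonal unitary with diagonal entries $e^{j\phi_k(\mathscr{A})}$, $\phi_k(\mathscr A)\in(-\pi,\pi]$, ordered $\phi_1(\mathscr{A})\ge\dots\ge\phi_{mp}(\mathscr{A})$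 with $\phi_1-\phi_{mp}<\pi$; these canonical T-phases do not depend on the decomposition. Put $\overline{\phi}(\mathscr{A})=\phi_1(\mathscr{A})$ and $\underline{\phi}(\mathscr{A})=\phi_{mp}(\mathscr{A})$. For real $\alpha,\beta$ with $0<\beta-\alpha\le\pi$ and $\frac{\alpha+\beta}{2}\in(-\pi,\pi]$, a sectorial tensor lies in $\mathcal{C}[\alpha,\beta]$ if $[\underline{\phi}(\mathscr{A}),\overline{\phi}(\mathscr{A})]\subseteq[\alpha,\beta]$. It is quasi-sectorial if it lies in $\mathcal{C}[\alpha,\beta]$ for some such $\alpha,\beta$ with $\beta-\alpha<\pi$, and semi-sectorial if it lies in $\mathcal{C}[\alpha,\beta]$ for some such $\alpha,\beta$ with $\beta-\alpha\le\pi$. Frequency-wise means that the property holds for the value at $j\omega$ for every frequency $\omega\in[0,\infty]$. *)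

theory Defs
  imports
    "Jordan_Normal_Form.Schur_Decomposition"
    "HOL-Computational_Algebra.Computational_Algebra"
    "HOL-Computational_Algebra.Field_as_Ring"
    "HOL-Library.Extended_Real"
begin

section \<open>Third-order tensors and the T-product\<close>

text \<open>A tensor is the list of its frontal slices; slices are indexed from 0.\<close>

type_synonym 'a tensor = "'a mat list"

definition carrier_tensor :: "nat \<Rightarrow> nat \<Rightarrow> nat \<Rightarrow> 'a tensor set" where
  "carrier_tensor m n p = {A. length A = p \<and> set A \<subseteq> carrier_mat m n}"

text \<open>Block \<open>(r, c)\<close> of \<open>bcirc A\<close> is the slice with index \<open>(r - c) mod p\<close>;
  \<open>p\<close> is added before subtracting because the indices are natural numbers.\<close>

definition bcirc :: "'a tensor \<Rightarrow> 'a mat" where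
  "bcirc A = (let m = dim_row (A ! 0); n = dim_col (A ! 0); p = length A in
     mat (m * p) (n * p)
       (\<lambda>(i, j). (A ! ((i div m + (p - j div n)) mod p)) $$ (i mod m, j mod n)))"

definition tunfold :: "'a tensor \<Rightarrow> 'a mat" where
  "tunfold A = (let m = dim_row (A ! 0); n = dim_col (A ! 0); p = length A in
     mat (m * p) n (\<lambda>(i, j). (A ! (i div m)) $$ (i mod m, j)))"

definition tfold :: "nat \<Rightarrow> 'a mat \<Rightarrow> 'a tensor" where
  "tfold p M = (let m = dim_row M div p in
     map (\<lambda>k. mat m (dim_col M) (\<lambda>(i, j). M $$ (k * m + i, j))) [0..<p])"

definition tprod :: "'a :: semiring_0 tensor \<Rightarrow> 'a tensor \<Rightarrow> 'a tensor" (infixl \<open>\<star>\<^sub>T\<close> 70) where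
  "A \<star>\<^sub>T B = tfold (length A) (bcirc A * tunfold B)"

definition tplus :: "'a :: plus tensor \<Rightarrow> 'a tensor \<Rightarrow> 'a tensor" (infixl \<open>+\<^sub>T\<close> 65) where
  "A +\<^sub>T B = map2 (+) A B"

definition tid :: "nat \<Rightarrow> nat \<Rightarrow> 'a :: {zero, one} tensor" where
  "tid m p = map (\<lambda>k. if k = 0 then 1\<^sub>m m else 0\<^sub>m m m) [0..<p]"

lemma bcirc_tid:
  assumes "0 < m" "0 < p"
  shows "bcirc (tid m p) = (1\<^sub>m (m * p) :: 'a :: semiring_1 mat)"
proof -
  let ?I = "tid m p :: 'a tensor"
  have d: "dim_row (?I ! 0) = m" "dim_col (?I ! 0) = m" "length ?I = p"
    using assms by (auto simp: tid_def)
  have slice: "?I ! k = (if k = 0 then 1\<^sub>m m else 0\<^sub>m m m)" if "k < p" for k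
    using that by (simp add: tid_def)
  show ?thesis
  proof (rule eq_matI)
    fix i j assume "i < dim_row (1\<^sub>m (m * p) :: 'a mat)" "j < dim_col (1\<^sub>m (m * p) :: 'a mat)"
    then have ij: "i < m * p" "j < m * p" by simp_all
    let ?r = "i div m" and ?c = "j div m"
    let ?k = "(?r + (p - ?c)) mod p"
    have rc: "?r < p" "?c < p"
      using ij by (simp_all add: less_mult_imp_div_less mult.commute)
    have md: "i mod m < m" "j mod m < m" using assms by simp_all
    have k0: "?k = 0 \<longleftrightarrow> ?r = ?c"
    proof (cases "?c \<le> ?r")
      case True
      then have "?r + (p - ?c) = (?r - ?c) + p" using rc by linarith
      then have "?k = (?r - ?c) mod p" by (metis mod_add_self2)
      also have "\<dots> = ?r - ?c" using rc by (intro mod_less) linarith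
      finally show ?thesis using True by linarith
    next
      case False
      then have "?r + (p - ?c) < p" using rc by linarith
      then have "?k = ?r + (p - ?c)" by (rule mod_less)
      then show ?thesis using False rc by linarith
    qed
    have kp: "?k < p" using assms by (intro mod_less_divisor) simp
    have eq: "i = j \<longleftrightarrow> ?r = ?c \<and> i mod m = j mod m"
      by (metis div_mult_mod_eq)
    have "bcirc ?I $$ (i, j) = (?I ! ?k) $$ (i mod m, j mod m)"
      unfolding bcirc_def Let_def d using ij by simp
    also have "\<dots> = (if ?k = 0 then 1\<^sub>m m else 0\<^sub>m m m) $$ (i mod m, j mod m)"
      by (simp only: slice[OF kp])
    also have "\<dots> = (if i = j then 1 else 0)"
      unfolding k0 using md eq by (cases "?r = ?c") auto
    also have "\<dots> = 1\<^sub>m (m * p) $$ (i, j)" using ij by simp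
    finally show "bcirc ?I $$ (i, j) = 1\<^sub>m (m * p) $$ (i, j)" .
  qed (simp_all only: bcirc_def Let_def d dim_row_mat dim_col_mat index_one_mat)
qed

definition is_tinverse :: "'a :: semiring_1 tensor \<Rightarrow> 'a tensor \<Rightarrow> bool" where
  "is_tinverse A B \<longleftrightarrow> (let m = dim_row (A ! 0); p = length A in
     B \<in> carrier_tensor m m p \<and> A \<star>\<^sub>T B = tid m p \<and> B \<star>\<^sub>T A = tid m p)"

definition tinvertible :: "'a :: semiring_1 tensor \<Rightarrow> bool" where
  "tinvertible A \<longleftrightarrow> (\<exists>B. is_tinverse A B)"

definition tinv :: "'a :: semiring_1 tensor \<Rightarrow> 'a tensor" where
  "tinv A = (THE B. is_tinverse A B)"

definition tblock :: "'a tensor \<Rightarrow> 'a tensor \<Rightarrow> 'a tensor \<Rightarrow> 'a tensor \<Rightarrow> 'a tensor" where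
  "tblock A B C D =
     map (\<lambda>k. four_block_mat (A ! k) (B ! k) (C ! k) (D ! k)) [0..<length A]"

section \<open>Real-rational systems\<close>

text \<open>Real-rational functions of \<open>s\<close> are elements of the field of fractions of \<open>\<real>[s]\<close>,
  so that inverses of transfer tensors are taken over the field of rational functions rather
  than pointwise in \<open>s\<close>. The pair \<open>quot_of_fract r\<close> is in lowest terms; hence the zeros of its
  second component are exactly the poles of \<open>r\<close>.\<close>

definition rat_num :: "real poly fract \<Rightarrow> real poly" where
  "rat_num r = fst (quot_of_fract r)"

definition rat_den :: "real poly fract \<Rightarrow> real poly" where
  "rat_den r = snd (quot_of_fract r)"

definition rat_value :: "real poly fract \<Rightarrow> complex \<Rightarrow> complex" where
  "rat_value r s = poly (map_poly of_real (rat_num r)) s / poly (map_poly of_real (rat_den r)) s"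

definition rat_proper :: "real poly fract \<Rightarrow> bool" where
  "rat_proper r \<longleftrightarrow> degree (rat_num r) \<le> degree (rat_den r)"

definition rat_stable :: "real poly fract \<Rightarrow> bool" where
  "rat_stable r \<longleftrightarrow> (\<forall>s :: complex. poly (map_poly of_real (rat_den r)) s = 0 \<longrightarrow> Re s < 0)"

definition RH_inf :: "nat \<Rightarrow> real poly fract mat set" where
  "RH_inf k = {M \<in> carrier_mat k k.
     \<forall>i < k. \<forall>j < k. rat_proper (M $$ (i, j)) \<and> rat_stable (M $$ (i, j))}"

definition RH_inf_tensor :: "nat \<Rightarrow> nat \<Rightarrow> real poly fract tensor set" where
  "RH_inf_tensor m p = {G \<in> carrier_tensor m m p. bcirc G \<in> RH_inf (m * p)}"

text \<open>The value at \<open>j\<omega>\<close> for \<open>\<omega> \<in> [0, \<infinity>]\<close>, the value at \<open>j\<infinity>\<close> being the entrywise limit.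
  Only arguments different from \<open>-\<infinity>\<close> are meaningful.\<close>

definition rat_freq :: "real poly fract \<Rightarrow> ereal \<Rightarrow> complex" where
  "rat_freq r \<omega> =
     (if \<omega> = \<infinity> then Lim at_top (\<lambda>w :: real. rat_value r (\<i> * of_real w))
      else rat_value r (\<i> * of_real (real_of_ereal \<omega>)))"

definition freq_response :: "real poly fract tensor \<Rightarrow> ereal \<Rightarrow> complex tensor" where
  "freq_response G \<omega> = map (map_mat (\<lambda>r. rat_freq r \<omega>)) G"

definition frequency_wise :: "(complex tensor \<Rightarrow> bool) \<Rightarrow> real poly fract tensor \<Rightarrow> bool" where
  "frequency_wise P G \<longleftrightarrow> (\<forall>\<omega> \<ge> 0. P (freq_response G \<omega>))"

definition return_difference ::
    "nat \<Rightarrow> nat \<Rightarrow> real poly fract tensor \<Rightarrow> real poly fract tensor \<Rightarrow> real poly fract tensor" where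
  "return_difference m p G H = tid m p +\<^sub>T H \<star>\<^sub>T G"

definition feedback ::
    "nat \<Rightarrow> nat \<Rightarrow> real poly fract tensor \<Rightarrow> real poly fract tensor \<Rightarrow> real poly fract tensor" where
  "feedback m p G H = (let S = tinv (return_difference m p G H) in
     tblock S (S \<star>\<^sub>T H) (G \<star>\<^sub>T S) (G \<star>\<^sub>T S \<star>\<^sub>T H))"

definition feedback_stable ::
    "nat \<Rightarrow> nat \<Rightarrow> real poly fract tensor \<Rightarrow> real poly fract tensor \<Rightarrow> bool" where
  "feedback_stable m p G H \<longleftrightarrow>
     tinvertible (return_difference m p G H) \<and> feedback m p G H \<in> RH_inf_tensor (2 * m) p"

section \<open>Numerical range and canonical T-phases\<close>

definition numerical_range :: "complex tensor \<Rightarrow> complex set" where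
  "numerical_range A =
     {conjugate x \<bullet> (bcirc A *\<^sub>v x) | x. x \<in> carrier_vec (dim_col (bcirc A)) \<and> conjugate x \<bullet> x = 1}"

definition sectorial :: "complex tensor \<Rightarrow> bool" where
  "sectorial A \<longleftrightarrow> 0 \<notin> numerical_range A"

definition canonical_phases :: "complex tensor \<Rightarrow> real list \<Rightarrow> bool" where
  "canonical_phases A \<phi> \<longleftrightarrow> (let n = dim_row (bcirc A) in
     length \<phi> = n \<and> set \<phi> \<subseteq> {-pi<..pi} \<and> sorted_wrt (\<ge>) \<phi> \<and> hd \<phi> - last \<phi> < pi \<and>
     (\<exists>T \<in> carrier_mat n n. invertible_mat T \<and>
        bcirc A = mat_adjoint T * mat_diag n (\<lambda>k. cis (\<phi> ! k)) * T))"

text \<open>The list of phases of a sectorial tensor does not depend on the decomposition, so the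
  choice operator only names it. A sectorial tensor whose numerical range crosses the negative
  real axis may have no phases in this normalization; its phases are then unspecified.\<close>

definition tphases :: "complex tensor \<Rightarrow> real list" where
  "tphases A = (SOME \<phi>. canonical_phases A \<phi>)"

definition phase_max :: "complex tensor \<Rightarrow> real" where
  "phase_max A = hd (tphases A)"

definition phase_min :: "complex tensor \<Rightarrow> real" where
  "phase_min A = last (tphases A)"

definition phase_bounds :: "real \<Rightarrow> real \<Rightarrow> bool" where
  "phase_bounds \<alpha> \<beta> \<longleftrightarrow> 0 < \<beta> - \<alpha> \<and> \<beta> - \<alpha> \<le> pi \<and> (\<alpha> + \<beta>) / 2 \<in> {-pi<..pi}"

definition phase_class :: "real \<Rightarrow> real \<Rightarrow> complex tensor set" where
  "phase_class \<alpha> \<beta> = {A. sectorial A \<and> {phase_min A..phase_max A} \<subseteq> {\<alpha>..\<beta>}}"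

definition quasi_sectorial :: "complex tensor \<Rightarrow> bool" where
  "quasi_sectorial A \<longleftrightarrow> (\<exists>\<alpha> \<beta>. phase_bounds \<alpha> \<beta> \<and> \<beta> - \<alpha> < pi \<and> A \<in> phase_class \<alpha> \<beta>)"

definition semi_sectorial :: "complex tensor \<Rightarrow> bool" where
  "semi_sectorial A \<longleftrightarrow> (\<exists>\<alpha> \<beta>. phase_bounds \<alpha> \<beta> \<and> \<beta> - \<alpha> \<le> pi \<and> A \<in> phase_class \<alpha> \<beta>)"

definition negative_real_axis :: "complex set" where
  "negative_real_axis = {z. Im z = 0 \<and> Re z < 0}"

end

theory Submission
  imports Defs "HOL-Complex_Analysis.Complex_Analysis" "Jordan_Normal_Form.Spectral_Radius"
begin

text \<open>If \<open>1 + t H G\<close> is singular at some frequency for some \<open>t > 0\<close>, say with kernel vector \<open>x\<close>, put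
  \<open>y = G x\<close>; then \<open>t (y\<^sup>H H y) = - cnj (x\<^sup>H G x)\<close>, so the arguments of the two forms add up to an odd
  multiple of \<open>\<pi>\<close>. The canonical decomposition places these arguments between the extremal phases,
  and the phase conditions exclude this. Hence \<open>det (1 + t H G)\<close> has no zero on the
  imaginary axis or at infinity for \<open>t \<in> [0, 1]\<close>. It equals \<open>1\<close> for \<open>t = 0\<close>, and by homotopy it has no zero
  in the right half plane for \<open>t = 1\<close> either, so it is a unit among the proper stable
  functions and Cramer's rule gives the stability of every block of the feedback tensor.\<close>

unbundle no vec_syntax
unbundle no fps_syntax
no_notation fps_nth (infixl \<open>$\<close> 75)
hide_type (open) Finite_Cartesian_Product.vec
hide_const (open) Determinants.det Finite_Cartesian_Product.vec Finite_Cartesian_Product.mat Finite_Cartesian_Product.row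
  Finite_Cartesian_Product.transpose

section \<open>Sesquilinear forms and canonical phases\<close>

text \<open>The phases are named by a choice operator, so a phase condition says something about the
  form only after a canonical list has been shown to exist. At finite frequencies existence follows
  from the hypotheses on the numerical ranges; at infinite frequency the negative real axis is not
  excluded by assumption, and that case needs a limit argument which uses that the value there is a
  real matrix. Everything about phases rests on one convexity fact: a form that vanishes at no
  nonzero vector can be diagonalised by congruence, so its values on nonzero vectors form a convex
  cone. The factor t can serve as homotopy parameter because positive scaling leaves arguments
  unchanged. The closed right half plane is not compact, so the homotopy runs on the closed unit
  disc, with the point 1 standing for infinity. Since poles spoil the additivity and
  multiplicativity of evaluation, determinants are evaluated inside the ring of proper stable
  functions, where evaluation is a homomorphism.\<close>

definition sesq :: "complex mat \<Rightarrow> complex vec \<Rightarrow> complex vec \<Rightarrow> complex" where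
  "sesq A x y = scalar_prod (conjugate x) (A *\<^sub>v y)"

lemma mat_adjoint_index:
  assumes "i < dim_col A" "j < dim_row A"
  shows "mat_adjoint A $$ (i, j) = conjugate (A $$ (j, i))"
  using assms unfolding mat_adjoint_def by (simp add: mat_of_rows_index)

lemma mat_adjoint_dim [simp]: "dim_row (mat_adjoint A) = dim_col A" "dim_col (mat_adjoint A) = dim_row A"
  unfolding mat_adjoint_def by simp_all

lemma mat_adjoint_carrier: "A \<in> carrier_mat n k \<Longrightarrow> mat_adjoint A \<in> carrier_mat k n"
  by auto

lemma mat_adjoint_times:
  fixes A B :: "complex mat"
  assumes "A \<in> carrier_mat n k" "B \<in> carrier_mat k l"
  shows "mat_adjoint (A * B) = mat_adjoint B * mat_adjoint A"
  using assms by (intro eq_matI) (auto simp: mat_adjoint_index scalar_prod_def mult.commute)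

lemma conjugate_scalar_prod:
  fixes u w :: "complex vec"
  assumes "u \<in> carrier_vec n" "w \<in> carrier_vec n"
  shows "scalar_prod (conjugate w) u = cnj (scalar_prod (conjugate u) w)"
  using assms by (auto simp: scalar_prod_def intro!: sum.cong)

lemma sesq_sum:
  assumes "A \<in> carrier_mat n k" "x \<in> carrier_vec n" "y \<in> carrier_vec k"
  shows "sesq A x y = (\<Sum>i<n. \<Sum>j<k. cnj (x $ i) * A $$ (i, j) * y $ j)"
  using assms unfolding sesq_def scalar_prod_def
  by (auto simp: scalar_prod_def sum_distrib_left atLeast0LessThan mult.assoc intro!: sum.cong)

lemma sesq_adjoint:
  assumes "A \<in> carrier_mat n k" "x \<in> carrier_vec k" "y \<in> carrier_vec n"
  shows "sesq (mat_adjoint A) x y = cnj (sesq A y x)"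
proof -
  have "sesq (mat_adjoint A) x y = (\<Sum>i<k. \<Sum>j<n. cnj (x $ i) * cnj (A $$ (j, i)) * y $ j)"
    using assms by (subst sesq_sum[OF mat_adjoint_carrier[OF assms(1)]]) (auto simp: mat_adjoint_index intro!: sum.cong)
  also have "\<dots> = (\<Sum>j<n. \<Sum>i<k. cnj (cnj (y $ j) * A $$ (j, i) * x $ i))"
    by (subst sum.swap) (auto intro!: sum.cong)
  finally show ?thesis by (simp add: sesq_sum[OF assms(1,3,2)])
qed

lemma sesq_times_right:
  assumes "A \<in> carrier_mat n k" "B \<in> carrier_mat k l" "x \<in> carrier_vec n" "y \<in> carrier_vec l"
  shows "sesq (A * B) x y = sesq A x (B *\<^sub>v y)"
  unfolding sesq_def assoc_mult_mat_vec[OF assms(1,2,4)] ..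

lemma sesq_times_left:
  assumes "A \<in> carrier_mat n k" "B \<in> carrier_mat n l" "x \<in> carrier_vec l" "y \<in> carrier_vec k"
  shows "sesq (mat_adjoint B * A) x y = sesq A (B *\<^sub>v x) y"
proof -
  have "sesq (mat_adjoint B * A) x y = sesq (mat_adjoint B) x (A *\<^sub>v y)"
    using assms by (intro sesq_times_right) auto
  also have "\<dots> = cnj (sesq B (A *\<^sub>v y) x)"
    using assms by (intro sesq_adjoint) auto
  also have "sesq B (A *\<^sub>v y) x = cnj (sesq A (B *\<^sub>v x) y)"
  proof -
    have "B *\<^sub>v x \<in> carrier_vec n" "A *\<^sub>v y \<in> carrier_vec n" using assms by auto
    then show ?thesis unfolding sesq_def by (rule conjugate_scalar_prod)
  qed
  finally show ?thesis by simp
qed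

lemma sesq_smult_right:
  assumes "A \<in> carrier_mat n k" "x \<in> carrier_vec n" "y \<in> carrier_vec k"
  shows "sesq A x (c \<cdot>\<^sub>v y) = c * sesq A x y"
  using assms unfolding sesq_def
  by (simp add: mult_mat_vec[OF assms(1)])

lemma sesq_smult_left:
  assumes "A \<in> carrier_mat n k" "x \<in> carrier_vec n" "y \<in> carrier_vec k"
  shows "sesq A (c \<cdot>\<^sub>v x) y = cnj c * sesq A x y"
  using assms unfolding sesq_def by (simp add: conjugate_smult_vec)

lemma sesq_zero_right [simp]: "A \<in> carrier_mat n k \<Longrightarrow> x \<in> carrier_vec n \<Longrightarrow> sesq A x (0\<^sub>v k) = 0"
  by (simp add: sesq_sum)

text \<open>One coordinate of a hyperplane is determined by the others: the equation with
  coefficients \<open>r\<close> is solved for a pivot \<open>j\<close>, and \<open>B\<close> sends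
  the free coordinates to the solution. Injectivity holds because the free coordinates reappear
  unchanged.\<close>

lemma hyperplane_param:
  fixes r :: "complex vec"
  assumes r: "r \<in> carrier_vec (Suc n)"
  shows "\<exists>B \<in> carrier_mat (Suc n) n. \<forall>y \<in> carrier_vec n.
    scalar_prod r (B *\<^sub>v y) = 0 \<and> (B *\<^sub>v y = 0\<^sub>v (Suc n) \<longrightarrow> y = 0\<^sub>v n)"
proof -
  \<comment> \<open>For \<open>r = 0\<close> the pivot is arbitrary: the quotients in
    \<open>B\<close> are then 0 by division by zero, and the equation holds for every
    vector.\<close>
  obtain j where j: "j \<le> n" "r $ j = 0 \<Longrightarrow> r = 0\<^sub>v (Suc n)"
  proof (cases "\<exists>j\<le>n. r $ j \<noteq> 0")
    case True then show ?thesis using that by auto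
  next
    case False
    then have "r = 0\<^sub>v (Suc n)" using r by (intro eq_vecI) auto
    then show ?thesis using that[of 0] by auto
  qed
  \<comment> \<open>\<open>sk\<close> enumerates the indices other than \<open>j\<close> in
    increasing order; \<open>w\<close> is minus the solved coordinate.\<close>
  define sk where "sk k = (if k < j then k else Suc k)" for k
  define w where "w y = (\<Sum>k<n. r $ sk k * y $ k) / r $ j" for y
  define B where "B = mat (Suc n) n (\<lambda>(i, k). if i = j then - r $ sk k / r $ j else if i = sk k then 1 else 0)"
  have Bc: "B \<in> carrier_mat (Suc n) n" by (simp add: B_def)
  have sk: "sk k < Suc n" "sk k \<noteq> j" if "k < n" for k using that j by (auto simp: sk_def)
  have inj: "inj_on sk {..<n}" by (auto simp: inj_on_def sk_def split: if_splits)
  have skimg: "sk ` {..<n} = {..<Suc n} - {j}"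
  proof (rule card_subset_eq)
    show "card (sk ` {..<n}) = card ({..<Suc n} - {j})" using inj j by (simp add: card_image)
  qed (use sk in auto)
  have Bj: "(B *\<^sub>v y) $ j = - w y" if "y \<in> carrier_vec n" for y
  proof -
    have "(B *\<^sub>v y) $ j = (\<Sum>k<n. - (r $ sk k * y $ k / r $ j))"
      using that j by (auto simp: B_def scalar_prod_def atLeast0LessThan intro!: sum.cong)
    then show ?thesis by (simp add: w_def sum_negf sum_divide_distrib)
  qed
  have Bs: "(B *\<^sub>v y) $ sk k = y $ k" if "y \<in> carrier_vec n" "k < n" for y k
  proof -
    have "(B *\<^sub>v y) $ sk k = (\<Sum>l<n. (if sk k = sk l then 1 else 0) * y $ l)"
      using that sk[OF that(2)] by (auto simp: B_def scalar_prod_def atLeast0LessThan intro!: sum.cong)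
    also have "\<dots> = (\<Sum>l<n. if k = l then y $ l else 0)"
      using inj that by (intro sum.cong) (auto simp: inj_on_def)
    finally show ?thesis using that by simp
  qed
  show ?thesis
  proof (intro bexI[OF _ Bc] ballI conjI impI)
    fix y :: "complex vec" assume y: "y \<in> carrier_vec n"
    have "scalar_prod r (B *\<^sub>v y) = (\<Sum>i<Suc n. r $ i * (B *\<^sub>v y) $ i)"
      unfolding scalar_prod_def using Bc by (auto simp: atLeast0LessThan)
    also have "\<dots> = r $ j * (B *\<^sub>v y) $ j + (\<Sum>i\<in>{..<Suc n} - {j}. r $ i * (B *\<^sub>v y) $ i)"
      using j by (intro sum.remove) auto
    also have "(\<Sum>i\<in>{..<Suc n} - {j}. r $ i * (B *\<^sub>v y) $ i) = (\<Sum>k<n. r $ sk k * y $ k)"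
      unfolding skimg[symmetric] using inj by (subst sum.reindex) (auto simp: Bs[OF y] intro!: sum.cong)
    also have "r $ j * (B *\<^sub>v y) $ j + \<dots> = 0"
    proof (cases "r $ j = 0")
      case True
      then have "r = 0\<^sub>v (Suc n)" using j by simp
      then show ?thesis using sk j by (auto intro!: sum.neutral)
    next
      case False then show ?thesis by (simp add: Bj[OF y] w_def)
    qed
    finally show "scalar_prod r (B *\<^sub>v y) = 0" .
    assume "B *\<^sub>v y = 0\<^sub>v (Suc n)"
    then show "y = 0\<^sub>v n" using Bs[OF y] sk y by (intro eq_vecI) (metis carrier_vecD index_zero_vec(1,2))+
  qed
qed

text \<open>An eigenvector \<open>v\<close> of \<open>(A\<^sup>H)\<^sup>-\<^sup>1 A\<close> satisfies \<open>A v = \<mu> A\<^sup>H v\<close>, so left and right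
  \<open>A\<close>-orthogonality to \<open>v\<close> agree, and the form can be restricted to the complement of \<open>v\<close>.\<close>

definition anisotropic :: "complex mat \<Rightarrow> bool" where
  "anisotropic A \<longleftrightarrow> (\<forall>x \<in> carrier_vec (dim_row A). x \<noteq> 0\<^sub>v (dim_row A) \<longrightarrow> sesq A x x \<noteq> 0)"

lemma anisotropicD:
  "anisotropic A \<Longrightarrow> A \<in> carrier_mat n n \<Longrightarrow> x \<in> carrier_vec n \<Longrightarrow> x \<noteq> 0\<^sub>v n \<Longrightarrow> sesq A x x \<noteq> 0"
  by (auto simp: anisotropic_def)

lemma sesq_orthogonal_basis:
  assumes "A \<in> carrier_mat n n"
    and "anisotropic A"
  shows "\<exists>x :: nat \<Rightarrow> complex vec. (\<forall>i<n. x i \<in> carrier_vec n \<and> x i \<noteq> 0\<^sub>v n) \<and>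
    (\<forall>i<n. \<forall>k<n. i \<noteq> k \<longrightarrow> sesq A (x i) (x k) = 0)"
  using assms
proof (induction n arbitrary: A)
  case 0 then show ?case by simp
next
  case (Suc n)
  let ?N = "Suc n" let ?H = "mat_adjoint A"
  note A = Suc.prems(1)
  have H: "?H \<in> carrier_mat ?N ?N" using A by auto
  \<comment> \<open>A kernel vector of the adjoint would be isotropic for \<open>A\<close>.\<close>
  have detH: "det ?H \<noteq> 0"
  proof
    assume "det ?H = 0"
    then obtain x where x: "x \<in> carrier_vec ?N" "x \<noteq> 0\<^sub>v ?N" "?H *\<^sub>v x = 0\<^sub>v ?N"
      using det_0_iff_vec_prod_zero_field[OF H] by auto
    then have "sesq ?H x x = 0" by (auto simp: sesq_def)
    then show False using sesq_adjoint[OF A x(1) x(1)] anisotropicD[OF Suc.prems(2) A x(1,2)] by simp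
  qed
  then obtain K where K: "K \<in> carrier_mat ?N ?N" "?H * K = 1\<^sub>m ?N"
    using det_non_zero_imp_unit[OF H] by (auto simp: Units_def ring_mat_def)
  obtain \<mu> where "\<mu> \<in> spectrum (K * A)"
    using spectrum_non_empty[of "K * A" ?N] K A by auto
  then obtain v where v: "v \<in> carrier_vec ?N" "v \<noteq> 0\<^sub>v ?N" "(K * A) *\<^sub>v v = \<mu> \<cdot>\<^sub>v v"
    using K A by (auto simp: spectrum_def eigenvalue_def eigenvector_def)
  have Av: "A *\<^sub>v v = \<mu> \<cdot>\<^sub>v (?H *\<^sub>v v)"
  proof -
    have "A *\<^sub>v v = (?H * K * A) *\<^sub>v v" using K A by simp
    also have "?H * K * A = ?H * (K * A)" by (rule assoc_mult_mat[OF H K(1) A])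
    also have "\<dots> *\<^sub>v v = ?H *\<^sub>v ((K * A) *\<^sub>v v)"
      by (rule assoc_mult_mat_vec[OF H mult_carrier_mat[OF K(1) A] v(1)])
    also have "\<dots> = \<mu> \<cdot>\<^sub>v (?H *\<^sub>v v)" unfolding v(3) by (rule mult_mat_vec[OF H v(1)])
    finally show ?thesis .
  qed
  \<comment> \<open>The hyperplane consists of the z with \<open>sesq A v z = 0\<close>: the
    conjugate of the adjoint applied to \<open>v\<close> is the coefficient vector of this
    functional.\<close>
  obtain B where B: "B \<in> carrier_mat ?N n"
    and Bv: "\<And>y. y \<in> carrier_vec n \<Longrightarrow> scalar_prod (?H *\<^sub>v v) (conjugate (B *\<^sub>v y)) = 0"
    and Binj: "\<And>y. y \<in> carrier_vec n \<Longrightarrow> B *\<^sub>v y = 0\<^sub>v ?N \<Longrightarrow> y = 0\<^sub>v n"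
  proof -
    obtain B where B: "B \<in> carrier_mat ?N n" "\<forall>y \<in> carrier_vec n.
      scalar_prod (conjugate (?H *\<^sub>v v)) (B *\<^sub>v y) = 0 \<and> (B *\<^sub>v y = 0\<^sub>v (Suc n) \<longrightarrow> y = 0\<^sub>v n)"
      using hyperplane_param[of "conjugate (?H *\<^sub>v v)" n] H v by auto
    have "scalar_prod (?H *\<^sub>v v) (conjugate (B *\<^sub>v y)) = 0" if "y \<in> carrier_vec n" for y
    proof -
      have "B *\<^sub>v y \<in> carrier_vec ?N" "?H *\<^sub>v v \<in> carrier_vec ?N" using B that v H by auto
      then show ?thesis using B that
        by (metis carrier_vec_conjugate conjugate_conjugate_sprod conjugate_vec_sprod_comm conjugate_zero_iff)
    qed
    then show ?thesis using that B by blast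
  qed
  have right: "sesq A (B *\<^sub>v y) v = 0" and left: "sesq A v (B *\<^sub>v y) = 0" if y: "y \<in> carrier_vec n" for y
  proof -
    have By: "B *\<^sub>v y \<in> carrier_vec ?N" using B y by auto
    have *: "sesq ?H (B *\<^sub>v y) v = 0"
      unfolding sesq_def using Bv[OF y] By H v(1) by (metis carrier_vec_conjugate comm_scalar_prod mult_mat_vec_carrier)
    show "sesq A (B *\<^sub>v y) v = 0"
      using * By H v(1) unfolding sesq_def Av
      by (subst scalar_prod_smult_distrib[of _ ?N]) auto
    show "sesq A v (B *\<^sub>v y) = 0"
      using * sesq_adjoint[OF A By v(1)] by simp
  qed
  \<comment> \<open>The form in the coordinates of the hyperplane. Injectivity of \<open>B\<close>
    keeps it anisotropic, so the induction hypothesis applies.\<close>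
  define A' where "A' = mat_adjoint B * (A * B)"
  have A': "A' \<in> carrier_mat n n" using A B by (auto simp: A'_def)
  have sA': "sesq A' y z = sesq A (B *\<^sub>v y) (B *\<^sub>v z)" if "y \<in> carrier_vec n" "z \<in> carrier_vec n" for y z
    unfolding A'_def using A B that
    by (subst sesq_times_left[of _ ?N n _ n]) (auto intro!: sesq_times_right)
  obtain x where x: "\<forall>i<n. x i \<in> carrier_vec n \<and> x i \<noteq> 0\<^sub>v n"
    "\<forall>i<n. \<forall>k<n. i \<noteq> k \<longrightarrow> sesq A' (x i) (x k) = 0"
  proof -
    have "anisotropic A'"
      unfolding anisotropic_def carrier_matD(1)[OF A']
    proof (intro ballI impI)
      fix y :: "complex vec" assume y: "y \<in> carrier_vec n" "y \<noteq> 0\<^sub>v n"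
      then have "B *\<^sub>v y \<noteq> 0\<^sub>v ?N" using Binj by blast
      then show "sesq A' y y \<noteq> 0"
        unfolding sA'[OF y(1) y(1)] by (rule anisotropicD[OF Suc.prems(2) A mult_mat_vec_carrier[OF B y(1)]])
    qed
    then show ?thesis using Suc.IH[OF A'] that by metis
  qed
  define X where "X i = (case i of 0 \<Rightarrow> v | Suc k \<Rightarrow> B *\<^sub>v x k)" for i
  show ?case
  proof (intro exI[of _ X] conjI allI impI)
    fix i assume i: "i < ?N"
    show "X i \<in> carrier_vec ?N" "X i \<noteq> 0\<^sub>v ?N" using i v x B Binj by (auto simp: X_def split: nat.splits)
    fix k assume "k < ?N" "i \<noteq> k"
    then show "sesq A (X i) (X k) = 0" using i x left right sA'
      by (auto simp: X_def split: nat.splits)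
  qed
qed

section \<open>Congruence to a diagonal matrix and the cone of values\<close>

lemma mat_adjoint_sandwich_index:
  assumes "A \<in> carrier_mat n n" "X \<in> carrier_mat n k" "i < k" "j < k"
  shows "(mat_adjoint X * (A * X)) $$ (i, j) = sesq A (col X i) (col X j)"
proof -
  have "row (mat_adjoint X) i = conjugate (col X i)"
    using assms by (intro eq_vecI) (auto simp: mat_adjoint_index)
  moreover have "col (A * X) j = A *\<^sub>v col X j"
    using assms by (intro col_mult2) auto
  ultimately show ?thesis using assms unfolding sesq_def by simp
qed

lemma invertible_mat_left_inverse:
  assumes "X \<in> carrier_mat n n" "det X \<noteq> (0 :: 'a :: field)"
  obtains T where "T \<in> carrier_mat n n" "invertible_mat T" "T * X = 1\<^sub>m n" "X * T = 1\<^sub>m n"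
proof -
  obtain T where T: "T \<in> carrier_mat n n" "T * X = 1\<^sub>m n" "X * T = 1\<^sub>m n"
    using det_non_zero_imp_unit[OF assms] by (auto simp: Units_def ring_mat_def)
  then have "invertible_mat T"
    using assms by (auto simp: invertible_mat_def inverts_mat_def intro!: exI[of _ X])
  then show ?thesis using that T by blast
qed

lemma invertible_matE:
  fixes T :: "'a :: field mat"
  assumes T: "T \<in> carrier_mat n n" "invertible_mat T"
  obtains S where "S \<in> carrier_mat n n" "T * S = 1\<^sub>m n" "S * T = 1\<^sub>m n"
proof -
  obtain S where S: "inverts_mat T S" "inverts_mat S T" using T(2) by (auto simp: invertible_mat_def)
  then have "S \<in> carrier_mat n n" using T(1)
    unfolding inverts_mat_def by (metis carrier_matD carrier_matI index_mult_mat(2,3) index_one_mat(2,3))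
  then show ?thesis using that S T(1) by (auto simp: inverts_mat_def)
qed

text \<open>With the vectors as columns of \<open>X\<close>, orthogonality says that the Gram matrix
  of the form is diagonal, and \<open>T\<close> is the inverse of \<open>X\<close>. Linear
  independence follows from the same identity, because the determinant of the diagonal matrix is
  nonzero.\<close>

lemma congruence_of_orthogonal_basis:
  assumes A: "A \<in> carrier_mat n n"
    and x: "\<And>k. k < n \<Longrightarrow> x k \<in> carrier_vec n"
    and d: "\<And>k. k < n \<Longrightarrow> sesq A (x k) (x k) = d k" "\<And>k. k < n \<Longrightarrow> d k \<noteq> 0"
    and orth: "\<And>i k. i < n \<Longrightarrow> k < n \<Longrightarrow> i \<noteq> k \<Longrightarrow> sesq A (x i) (x k) = 0"
  shows "\<exists>T \<in> carrier_mat n n. invertible_mat T \<and> A = mat_adjoint T * mat_diag n d * T"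
proof -
  define X where "X = mat n n (\<lambda>(i, k). x k $ i)"
  have X: "X \<in> carrier_mat n n" by (simp add: X_def)
  have col: "col X k = x k" if "k < n" for k
    using x[OF that] that by (intro eq_vecI) (auto simp: X_def)
  define D where "D = mat_diag n d"
  have D: "D \<in> carrier_mat n n" by (simp add: D_def mat_diag_def)
  have eq: "mat_adjoint X * (A * X) = D"
  proof (rule eq_matI)
    fix i j assume "i < dim_row D" "j < dim_col D"
    then have ij: "i < n" "j < n" using D by auto
    then show "(mat_adjoint X * (A * X)) $$ (i, j) = D $$ (i, j)"
      unfolding mat_adjoint_sandwich_index[OF A X ij] using d orth
      by (auto simp: col D_def mat_diag_def)
  qed (use X A D in auto)
  have "det D = prod_list (diag_mat D)"
    using D by (intro det_upper_triangular) (auto simp: D_def mat_diag_def upper_triangular_def)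
  also have "\<dots> \<noteq> 0" using d(2) by (auto simp: prod_list_zero_iff diag_mat_def D_def mat_diag_def)
  finally have "det (mat_adjoint X) * (det A * det X) \<noteq> 0"
    unfolding eq[symmetric]
    by (simp add: det_mult[OF mat_adjoint_carrier[OF X] mult_carrier_mat[OF A X]] det_mult[OF A X])
  then have "det X \<noteq> 0" by auto
  then obtain T where T: "T \<in> carrier_mat n n" "invertible_mat T" "T * X = 1\<^sub>m n" "X * T = 1\<^sub>m n"
    using invertible_mat_left_inverse[OF X] by blast
  note Xa = mat_adjoint_carrier[OF X] and Ta = mat_adjoint_carrier[OF T(1)]
  have TX: "mat_adjoint T * mat_adjoint X = 1\<^sub>m n"
  proof -
    have "mat_adjoint (1\<^sub>m n :: complex mat) = 1\<^sub>m n"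
      by (rule eq_matI) (auto simp: mat_adjoint_index)
    then show ?thesis using mat_adjoint_times[OF X T(1)] T(4) by simp
  qed
  have AX: "A * X \<in> carrier_mat n n" using A X by auto
  have "mat_adjoint T * D * T = mat_adjoint T * mat_adjoint X * (A * X) * T"
    unfolding eq[symmetric] by (subst assoc_mult_mat[OF Ta Xa AX]) (rule refl)
  also have "\<dots> = A * X * T" unfolding TX left_mult_one_mat[OF AX] ..
  also have "\<dots> = A" unfolding assoc_mult_mat[OF A X T(1)] T(4) by (rule right_mult_one_mat[OF A])
  finally show ?thesis using T D_def by auto
qed

text \<open>The weights of the diagonal entries are squared moduli, hence nonnegative. This is the
  link between the phases and the arguments of the values.\<close>

lemma sesq_congruence_diag:
  assumes T: "T \<in> carrier_mat n n" and x: "x \<in> carrier_vec n"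
  shows "sesq (mat_adjoint T * mat_diag n d * T) x x
    = (\<Sum>k<n. of_real ((cmod ((T *\<^sub>v x) $ k))\<^sup>2) * d k)"
proof -
  let ?D = "mat_diag n d" and ?u = "T *\<^sub>v x"
  have D: "?D \<in> carrier_mat n n" by (simp add: mat_diag_def)
  have u: "?u \<in> carrier_vec n" using T x by auto
  have "sesq (mat_adjoint T * ?D * T) x x = sesq (mat_adjoint T * ?D) x ?u"
    using T D x mat_adjoint_carrier[OF T] by (intro sesq_times_right[of _ n n]) auto
  also have "\<dots> = sesq ?D ?u ?u" by (rule sesq_times_left[OF D T x u])
  also have "\<dots> = (\<Sum>k<n. cnj (?u $ k) * d k * ?u $ k)"
    unfolding sesq_sum[OF D u u]
  proof (intro sum.cong refl)
    fix k assume k: "k \<in> {..<n}"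
    have "(\<Sum>j<n. cnj (?u $ k) * ?D $$ (k, j) * ?u $ j) = (\<Sum>j<n. if j = k then cnj (?u $ k) * d k * ?u $ k else 0)"
      using k by (intro sum.cong) (auto simp: mat_diag_def)
    then show "(\<Sum>j<n. cnj (?u $ k) * ?D $$ (k, j) * ?u $ j) = cnj (?u $ k) * d k * ?u $ k"
      using k by simp
  qed
  also have "\<dots> = (\<Sum>k<n. of_real ((cmod (?u $ k))\<^sup>2) * d k)"
    unfolding complex_norm_square by (intro sum.cong refl) (simp add: mult_ac)
  finally show ?thesis .
qed

text \<open>A conic version of the Toeplitz-Hausdorff theorem. In diagonal coordinates the squared
  moduli enter linearly, and any nonnegative weights are the squared moduli of some vector, so
  weights can be added.\<close>

lemma cone_closed_add:
  assumes A: "A \<in> carrier_mat n n"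
    and an: "anisotropic A"
    and x: "x \<in> carrier_vec n" "x \<noteq> 0\<^sub>v n" and y: "y \<in> carrier_vec n" "y \<noteq> 0\<^sub>v n"
    and "0 \<le> a" "0 \<le> b" "0 < a + b"
  shows "\<exists>z \<in> carrier_vec n. z \<noteq> 0\<^sub>v n \<and> sesq A z z = of_real a * sesq A x x + of_real b * sesq A y y"
proof -
  obtain e where e: "\<forall>i<n. e i \<in> carrier_vec n \<and> e i \<noteq> 0\<^sub>v n"
    "\<forall>i<n. \<forall>k<n. i \<noteq> k \<longrightarrow> sesq A (e i) (e k) = 0"
    using sesq_orthogonal_basis[OF A an] by metis
  obtain T where T: "T \<in> carrier_mat n n" "invertible_mat T"
      "A = mat_adjoint T * mat_diag n (\<lambda>k. sesq A (e k) (e k)) * T"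
    using congruence_of_orthogonal_basis[OF A, of e "\<lambda>k. sesq A (e k) (e k)"] e anisotropicD[OF an A] by auto
  let ?d = "\<lambda>k. sesq A (e k) (e k)"
  have form: "sesq A v v = (\<Sum>k<n. of_real ((cmod ((T *\<^sub>v v) $ k))\<^sup>2) * ?d k)" if "v \<in> carrier_vec n" for v
    using sesq_congruence_diag[OF T(1) that, of ?d] T(3) by simp
  define q where "q k = a * (cmod ((T *\<^sub>v x) $ k))\<^sup>2 + b * (cmod ((T *\<^sub>v y) $ k))\<^sup>2" for k
  have q: "q k \<ge> 0" for k using assms by (simp add: q_def)
  \<comment> \<open>A vector whose coordinates have the combined weights as squared moduli; its
    preimage under \<open>T\<close> is the witness.\<close>
  define u where "u = vec n (\<lambda>k. complex_of_real (sqrt (q k)))"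
  obtain S where S: "S \<in> carrier_mat n n" "T * S = 1\<^sub>m n" "S * T = 1\<^sub>m n"
    using invertible_matE[OF T(1,2)] .
  have Tz: "T *\<^sub>v (S *\<^sub>v u) = u"
    using assoc_mult_mat_vec[OF T(1) S(1), of u] S(2) by (simp add: u_def)
  have z: "S *\<^sub>v u \<in> carrier_vec n" using S by (auto simp: u_def)
  have eq: "sesq A (S *\<^sub>v u) (S *\<^sub>v u) = of_real a * sesq A x x + of_real b * sesq A y y"
    unfolding form[OF z] form[OF x(1)] form[OF y(1)] Tz sum_distrib_left sum.distrib[symmetric]
    using q by (intro sum.cong) (auto simp: u_def q_def algebra_simps)
  \<comment> \<open>If the witness were zero, all combined weights would vanish; whichever of
    \<open>a\<close> and \<open>b\<close> is positive then makes \<open>T\<close> annihilate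
    \<open>x\<close> or \<open>y\<close>, against anisotropy.\<close>
  have "S *\<^sub>v u \<noteq> 0\<^sub>v n"
  proof
    assume z0: "S *\<^sub>v u = 0\<^sub>v n"
    have "u = 0\<^sub>v n" using Tz unfolding z0 using T(1) by (intro eq_vecI) auto
    then have q0: "q k = 0" if "k < n" for k
    proof -
      have "u $ k = 0" using \<open>u = 0\<^sub>v n\<close> that by simp
      then show ?thesis using that by (simp add: u_def)
    qed
    have "v = 0\<^sub>v n" if "v \<in> carrier_vec n" "\<forall>k<n. (T *\<^sub>v v) $ k = 0" for v
    proof (rule ccontr)
      assume "v \<noteq> 0\<^sub>v n"
      then show False using anisotropicD[OF an A that(1)] form[OF that(1)] that(2) by simp
    qed
    moreover have "(\<forall>k<n. (T *\<^sub>v x) $ k = 0) \<or> (\<forall>k<n. (T *\<^sub>v y) $ k = 0)"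
    proof (cases "a = 0")
      case True
      then have "b > 0" using assms by auto
      then show ?thesis using q0 True by (auto simp: q_def simp del: index_mult_mat_vec)
    next
      case False
      then have "a > 0" using assms by auto
      then show ?thesis using q0 assms by (auto simp: q_def add_nonneg_eq_0_iff simp del: index_mult_mat_vec)
    qed
    ultimately show False using x y by blast
  qed
  then show ?thesis using z eq by blast
qed

text \<open>Rotation by the midpoint \<open>c\<close> moves all summands into the sector of
  half-opening \<open>d < pi / 2\<close> around the positive real axis. That sector is given by
  linear inequalities between real and imaginary part, so it is closed under nonnegative
  combinations. The angle obtained is a real number in the given interval, not merely an argument
  modulo \<open>2 * pi\<close>.\<close>

lemma cone_polar:
  fixes n :: nat
  assumes w: "\<And>k. k < n \<Longrightarrow> 0 \<le> w k" "\<exists>k<n. 0 < w k"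
    and \<phi>: "\<And>k. k < n \<Longrightarrow> a \<le> \<phi> k \<and> \<phi> k \<le> b" and ab: "b - a < pi"
  shows "\<exists>r \<alpha>. 0 < r \<and> a \<le> \<alpha> \<and> \<alpha> \<le> b \<and> (\<Sum>k<n. of_real (w k) * cis (\<phi> k)) = of_real r * cis \<alpha>"
proof -
  define c d where "c = (a + b) / 2" and "d = (b - a) / 2"
  have bds: "\<bar>\<phi> k - c\<bar> \<le> d" if "k < n" for k
    using \<phi>[OF that] unfolding c_def d_def by (auto simp: abs_le_iff field_simps)
  obtain k0 where k0: "k0 < n" "0 < w k0" using w(2) by blast
  have d: "0 \<le> d" "d < pi / 2" using abs_ge_zero[THEN order_trans, OF bds[OF k0(1)]] ab by (auto simp: d_def)
  define Z where "Z = (\<Sum>k<n. of_real (w k) * cis (\<phi> k - c))"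
  have cpos: "0 < cos (\<phi> k - c)" if "k < n" for k
    using bds[OF that] d by (intro cos_gt_zero_pi) auto
  have Re: "Re Z = (\<Sum>k<n. w k * cos (\<phi> k - c))" and Im: "Im Z = (\<Sum>k<n. w k * sin (\<phi> k - c))"
    by (simp_all add: Z_def)
  have "0 < Re Z" unfolding Re
    using w cpos k0 by (intro sum_pos2[of _ k0]) (auto intro!: mult_nonneg_nonneg less_imp_le[OF cpos])
  have abs_sin: "\<bar>sin x\<bar> = sin \<bar>x\<bar>" if "\<bar>x\<bar> < pi" for x :: real
    using sin_ge_zero[of "\<bar>x\<bar>"] that by (cases "0 \<le> x") auto
  have ImZ: "\<bar>Im Z\<bar> \<le> tan d * Re Z"
  proof -
    have "\<bar>Im Z\<bar> \<le> (\<Sum>k<n. \<bar>w k * sin (\<phi> k - c)\<bar>)" unfolding Im by (rule sum_abs)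
    also have "\<dots> \<le> (\<Sum>k<n. tan d * (w k * cos (\<phi> k - c)))"
    proof (rule sum_mono)
      fix k assume "k \<in> {..<n}"
      then have k: "k < n" by simp
      let ?x = "\<phi> k - c"
      have "\<bar>sin ?x\<bar> = sin \<bar>?x\<bar>"
        using abs_sin bds[OF k] d by simp
      also have "\<dots> = tan \<bar>?x\<bar> * cos ?x" using cpos[OF k] by (simp add: tan_def)
      also have "\<dots> \<le> tan d * cos ?x"
        using bds[OF k] d cpos[OF k] by (intro mult_right_mono tan_mono_le) auto
      finally have "w k * \<bar>sin ?x\<bar> \<le> w k * (tan d * cos ?x)" using w(1)[OF k] by (rule mult_left_mono)
      then show "\<bar>w k * sin ?x\<bar> \<le> tan d * (w k * cos ?x)"
        using w(1)[OF k] by (simp add: abs_mult mult_ac)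
    qed
    finally show ?thesis by (simp add: Re sum_distrib_left)
  qed
  have "\<bar>Arg Z\<bar> \<le> d"
  proof -
    have "\<bar>Im Z / Re Z\<bar> \<le> tan d" using ImZ \<open>0 < Re Z\<close> by (simp add: divide_le_eq)
    then have "Im Z / Re Z \<le> tan d" "- tan d \<le> Im Z / Re Z" by linarith+
    then have "arctan (Im Z / Re Z) \<le> arctan (tan d)" "arctan (- tan d) \<le> arctan (Im Z / Re Z)"
      by (simp_all add: arctan_le_iff)
    then show ?thesis using arg_conv_arctan[OF \<open>0 < Re Z\<close>] d by (simp add: arctan_tan arctan_minus abs_le_iff)
  qed
  moreover have "(\<Sum>k<n. of_real (w k) * cis (\<phi> k)) = of_real (cmod Z) * cis (c + Arg Z)"
  proof -
    have "Z \<noteq> 0" using \<open>0 < Re Z\<close> by auto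
    then have "of_real (cmod Z) * cis (Arg Z) = Z" by (simp add: cis_Arg sgn_div_norm scaleR_conv_of_real)
    then have "of_real (cmod Z) * cis (c + Arg Z) = cis c * Z"
      unfolding cis_mult[symmetric] by (simp add: mult_ac)
    also have "\<dots> = (\<Sum>k<n. of_real (w k) * cis (\<phi> k))"
      unfolding Z_def sum_distrib_left by (intro sum.cong) (auto simp: cis_mult mult.left_commute)
    finally show ?thesis by simp
  qed
  moreover have "0 < cmod Z" using \<open>0 < Re Z\<close> by auto
  ultimately show ?thesis
    by (intro exI[of _ "cmod Z"] exI[of _ "c + Arg Z"]) (auto simp: c_def d_def abs_le_iff field_simps)
qed

text \<open>The form in which phases are used later: angles of values are real numbers between the
  extreme phases, so the angles of two forms can be added without wrapping around.\<close>

lemma canonical_phases_polar: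
  assumes can: "canonical_phases A \<phi>" and A: "bcirc A \<in> carrier_mat n n"
    and x: "x \<in> carrier_vec n" "x \<noteq> 0\<^sub>v n"
  shows "\<exists>r \<alpha>. 0 < r \<and> last \<phi> \<le> \<alpha> \<and> \<alpha> \<le> hd \<phi> \<and> sesq (bcirc A) x x = of_real r * cis \<alpha>"
proof -
  have dim: "dim_row (bcirc A) = n" using A by simp
  note c = can[unfolded canonical_phases_def Let_def dim]
  then obtain T where T: "T \<in> carrier_mat n n" "invertible_mat T"
      "bcirc A = mat_adjoint T * mat_diag n (\<lambda>k. cis (\<phi> ! k)) * T" by blast
  have len: "length \<phi> = n" using c by simp
  \<comment> \<open>A nonzero vector excludes \<open>n = 0\<close>, where \<open>hd\<close> and
    \<open>last\<close> of the phase list would be unspecified.\<close>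
  have n0: "n > 0"
  proof (rule ccontr)
    assume "\<not> n > 0"
    then show False using x by (auto intro: eq_vecI)
  qed
  have ord: "last \<phi> \<le> \<phi> ! k \<and> \<phi> ! k \<le> hd \<phi>" if "k < n" for k
  proof -
    have s: "sorted_wrt (\<ge>) \<phi>" using c by simp
    have ne: "\<phi> \<noteq> []" using len n0 by auto
    have "\<phi> ! k \<le> \<phi> ! 0" using sorted_wrt_nth_less[OF s, of 0 k] that len by (cases "k = 0") auto
    moreover have "\<phi> ! (n - 1) \<le> \<phi> ! k"
      using sorted_wrt_nth_less[OF s, of k "n - 1"] that len by (cases "k = n - 1") auto
    ultimately show ?thesis using ne len by (simp add: hd_conv_nth last_conv_nth)
  qed
  have nz: "\<exists>k<n. (T *\<^sub>v x) $ k \<noteq> 0"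
  proof (rule ccontr)
    assume *: "\<not> (\<exists>k<n. (T *\<^sub>v x) $ k \<noteq> 0)"
    have "T *\<^sub>v x = 0\<^sub>v n" using T(1) * by (intro eq_vecI) auto
    moreover obtain S where S: "S \<in> carrier_mat n n" "T * S = 1\<^sub>m n" "S * T = 1\<^sub>m n"
      using invertible_matE[OF T(1,2)] .
    ultimately have "x = S *\<^sub>v 0\<^sub>v n"
      using assoc_mult_mat_vec[OF S(1) T(1) x(1)] S(3) x by simp
    then have "x = 0\<^sub>v n" using S(1) by (intro eq_vecI) auto
    then show False using x by simp
  qed
  show ?thesis
    unfolding T(3) sesq_congruence_diag[OF T(1) x(1)]
  proof (rule cone_polar)
    show "hd \<phi> - last \<phi> < pi" using c by simp
  qed (use nz ord in auto)
qed

text \<open>Stated for angle intervals instead of phases, so that it concerns two arbitrary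
  matrices. The bounds confine the sum of the two angles to the open interval from
  \<open>- pi\<close> to \<open>pi\<close>, where the sine vanishes only at 0; there the two terms
  have the same sign and cannot cancel.\<close>

lemma det_one_plus_product_nonzero:
  assumes M: "M \<in> carrier_mat n n" and N: "N \<in> carrier_mat n n"
    and pM: "\<And>x. x \<in> carrier_vec n \<Longrightarrow> x \<noteq> 0\<^sub>v n \<Longrightarrow>
      \<exists>r \<alpha>. 0 < r \<and> a1 \<le> \<alpha> \<and> \<alpha> \<le> b1 \<and> sesq M x x = of_real r * cis \<alpha>"
    and pN: "\<And>x. x \<in> carrier_vec n \<Longrightarrow> x \<noteq> 0\<^sub>v n \<Longrightarrow>
      \<exists>r \<alpha>. 0 < r \<and> a2 \<le> \<alpha> \<and> \<alpha> \<le> b2 \<and> sesq N x x = of_real r * cis \<alpha>"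
    and ab: "b1 + b2 < pi" "- pi < a1 + a2" and t: "0 \<le> (t :: real)"
  shows "det (1\<^sub>m n + of_real t \<cdot>\<^sub>m (N * M)) \<noteq> 0"
proof
  let ?t = "complex_of_real t"
  have NM: "?t \<cdot>\<^sub>m (N * M) \<in> carrier_mat n n" using M N by auto
  assume "det (1\<^sub>m n + ?t \<cdot>\<^sub>m (N * M)) = 0"
  then obtain x where x: "x \<in> carrier_vec n" "x \<noteq> 0\<^sub>v n" "(1\<^sub>m n + ?t \<cdot>\<^sub>m (N * M)) *\<^sub>v x = 0\<^sub>v n"
    using det_0_iff_vec_prod_zero_field[of "1\<^sub>m n + ?t \<cdot>\<^sub>m (N * M)" n] NM by auto
  define y where "y = M *\<^sub>v x"
  have y: "y \<in> carrier_vec n" using M x by (simp add: y_def)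
  have Ny: "N *\<^sub>v y \<in> carrier_vec n" using N y by auto
  have "x + ?t \<cdot>\<^sub>v (N *\<^sub>v y) = 0\<^sub>v n"
  proof -
    have "(1\<^sub>m n + ?t \<cdot>\<^sub>m (N * M)) *\<^sub>v x = 1\<^sub>m n *\<^sub>v x + (?t \<cdot>\<^sub>m (N * M)) *\<^sub>v x"
      by (rule add_mult_distrib_mat_vec[OF one_carrier_mat NM x(1)])
    also have "(?t \<cdot>\<^sub>m (N * M)) *\<^sub>v x = ?t \<cdot>\<^sub>v ((N * M) *\<^sub>v x)"
    proof -
      have "(?t \<cdot>\<^sub>m K) *\<^sub>v x = ?t \<cdot>\<^sub>v (K *\<^sub>v x)" if "K \<in> carrier_mat n n" for K
        using that x(1) by (intro eq_vecI) auto
      then show ?thesis using mult_carrier_mat[OF N M] by blast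
    qed
    also have "(N * M) *\<^sub>v x = N *\<^sub>v y" unfolding y_def by (rule assoc_mult_mat_vec[OF N M x(1)])
    finally show ?thesis using x by simp
  qed
  then have "scalar_prod (conjugate y) (x + ?t \<cdot>\<^sub>v (N *\<^sub>v y)) = 0" using y by simp
  moreover have "scalar_prod (conjugate y) (x + ?t \<cdot>\<^sub>v (N *\<^sub>v y))
      = scalar_prod (conjugate y) x + ?t * sesq N y y"
    unfolding sesq_def using x y Ny
    by (subst scalar_prod_add_distrib[of _ n]) (auto simp: scalar_prod_smult_distrib[of _ n])
  moreover have "scalar_prod (conjugate y) x = cnj (sesq M x x)"
    unfolding sesq_def y_def[symmetric] by (rule conjugate_scalar_prod[OF x(1) y])
  ultimately have eq: "cnj (sesq M x x) + ?t * sesq N y y = 0" by simp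
  obtain r \<alpha> where r: "0 < r" "a1 \<le> \<alpha>" "\<alpha> \<le> b1" "sesq M x x = of_real r * cis \<alpha>"
    using pM[OF x(1,2)] by blast
  have "y \<noteq> 0\<^sub>v n"
  proof
    assume "y = 0\<^sub>v n"
    then have "sesq M x x = 0" using x unfolding sesq_def y_def[symmetric] by simp
    then show False using r by simp
  qed
  then obtain s \<beta> where s: "0 < s" "a2 \<le> \<beta>" "\<beta> \<le> b2" "sesq N y y = of_real s * cis \<beta>"
    using pN[OF y] by blast
  have "of_real r * cis (- \<alpha>) + of_real (t * s) * cis \<beta> = 0"
    using eq unfolding r(4) s(4) by (simp add: cis_cnj mult.assoc)
  \<comment> \<open>Multiplication by \<open>cis \<alpha>\<close> makes the first term real and
    leaves only the sum of the angles in the second.\<close>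
  moreover have "cis \<alpha> * (of_real r * cis (- \<alpha>) + of_real (t * s) * cis \<beta>)
      = of_real r * (cis \<alpha> * cis (- \<alpha>)) + of_real (t * s) * (cis \<alpha> * cis \<beta>)"
    by (simp only: distrib_left mult.left_commute[of "cis \<alpha>"])
  ultimately have "of_real r + of_real (t * s) * cis (\<alpha> + \<beta>) = 0" by (simp add: cis_mult)
  then have "r + t * s * cos (\<alpha> + \<beta>) = 0" "t * s * sin (\<alpha> + \<beta>) = 0"
    by (simp_all add: complex_eq_iff)
  moreover have "\<bar>\<alpha> + \<beta>\<bar> < pi" using r s ab by auto
  \<comment> \<open>Otherwise the real part would be \<open>r\<close>, which is positive.\<close>
  moreover have "t * s \<noteq> 0" using calculation r by auto
  ultimately have "\<alpha> + \<beta> = 0" using sin_eq_0_pi by auto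
  moreover have "0 \<le> t * s" using t s by simp
  ultimately show False using \<open>r + t * s * cos (\<alpha> + \<beta>) = 0\<close> r by simp
qed

section \<open>Existence of canonical phases\<close>

text \<open>Division of \<open>x k\<close> by the square root of \<open>r k\<close> divides its
  value by \<open>r k\<close> and leaves the unimodular factor, so the diagonal of the congruence
  becomes unitary.\<close>

lemma canonical_phases_of_basis:
  assumes A: "bcirc A \<in> carrier_mat n n"
    and x: "\<And>k. k < n \<Longrightarrow> x k \<in> carrier_vec n"
    and d: "\<And>k. k < n \<Longrightarrow> 0 < r k \<and> sesq (bcirc A) (x k) (x k) = of_real (r k) * cis (\<phi> ! k)"
    and orth: "\<And>i k. i < n \<Longrightarrow> k < n \<Longrightarrow> i \<noteq> k \<Longrightarrow> sesq (bcirc A) (x i) (x k) = 0"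
    and \<phi>: "length \<phi> = n" "set \<phi> \<subseteq> {-pi<..pi}" "sorted_wrt (\<ge>) \<phi>" "hd \<phi> - last \<phi> < pi"
  shows "canonical_phases A \<phi>"
proof -
  define y where "y k = of_real (1 / sqrt (r k)) \<cdot>\<^sub>v x k" for k
  have y: "y k \<in> carrier_vec n" if "k < n" for k using x[OF that] by (simp add: y_def)
  have sy: "sesq (bcirc A) (y i) (y k) = of_real (1 / sqrt (r i) * (1 / sqrt (r k))) * sesq (bcirc A) (x i) (x k)"
    if "i < n" "k < n" for i k
    unfolding y_def using x[OF that(1)] x[OF that(2)]
    by (simp add: sesq_smult_left[OF A] sesq_smult_right[OF A])
  have "\<exists>T \<in> carrier_mat n n. invertible_mat T \<and>
    bcirc A = mat_adjoint T * mat_diag n (\<lambda>k. cis (\<phi> ! k)) * T"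
  proof (rule congruence_of_orthogonal_basis[OF A y])
    fix k assume k: "k < n"
    have "1 / sqrt (r k) * (1 / sqrt (r k)) * r k = 1"
      using d[OF k] by (simp add: field_simps)
    then show "sesq (bcirc A) (y k) (y k) = cis (\<phi> ! k)"
      unfolding sy[OF k k] using d[OF k]
      by (metis (no_types, lifting) mult.assoc mult_1 of_real_1 of_real_mult)
  qed (auto simp: sy orth)
  then show ?thesis using A \<phi> unfolding canonical_phases_def Let_def by auto
qed

text \<open>Up to sign, each number is divided by its modulus and weighted by the sine of the other
  argument. This cancels the imaginary parts and turns the real part into the sine of the difference
  of the arguments. That difference is at least \<open>pi\<close> and less than
  \<open>2 * pi\<close>, where the sine is nonpositive.\<close>

lemma sesq_nonpos_if_phase_spread:
  assumes z: "Im z \<noteq> 0 \<or> 0 < Re z" and w: "Im w \<noteq> 0 \<or> 0 < Re w" and spread: "pi \<le> Arg z - Arg w"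
  shows "\<exists>a b. 0 < a \<and> 0 < b \<and> Im (of_real a * z + of_real b * w) = 0 \<and> Re (of_real a * z + of_real b * w) \<le> 0"
proof -
  have nz: "z \<noteq> 0" "w \<noteq> 0" using z w by auto
  have "Arg z \<noteq> pi" using z by (auto simp: Arg_eq_pi)
  then have zb: "Arg z < pi" "0 < Arg z" using Arg_bounded[of z] Arg_bounded[of w] spread by auto
  have wb: "- pi < Arg w" "Arg w < 0" using Arg_bounded[of w] spread zb by auto
  have eq: "u = of_real (cmod u) * cis (Arg u)" if "u \<noteq> 0" for u
    using that by (simp add: cis_Arg sgn_div_norm scaleR_conv_of_real)
  define a b where "a = - sin (Arg w) / cmod z" and "b = sin (Arg z) / cmod w"
  have "sin (Arg w) < 0" using sin_gt_zero[of "- Arg w"] wb by simp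
  then have a: "0 < a" using nz by (simp add: a_def divide_neg_pos)
  have b: "0 < b" using nz sin_gt_zero[OF zb(2,1)] by (simp add: b_def)
  have "of_real a * z = of_real (- sin (Arg w)) * cis (Arg z)"
    by (subst eq[OF nz(1)], simp add: a_def nz)
  moreover have "of_real b * w = of_real (sin (Arg z)) * cis (Arg w)"
    by (subst eq[OF nz(2)], simp add: b_def nz)
  ultimately have s: "of_real a * z + of_real b * w = of_real (- sin (Arg w)) * cis (Arg z) + of_real (sin (Arg z)) * cis (Arg w)"
    by simp
  have "Re (of_real a * z + of_real b * w) = sin (Arg z - Arg w)"
    unfolding s by (simp add: sin_diff mult.commute)
  also have "\<dots> \<le> 0"
    using sin_ge_zero[of "Arg z - Arg w - pi"] spread zb wb by (simp add: sin_diff)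
  finally have "Re (of_real a * z + of_real b * w) \<le> 0" .
  moreover have "Im (of_real a * z + of_real b * w) = 0" unfolding s by (simp add: mult.commute)
  ultimately show ?thesis using a b by blast
qed

text \<open>The arguments of the values on an orthogonal basis serve as phases. A spread of
  \<open>pi\<close> or more would put a nonpositive real number into the convex cone of values,
  which anisotropy and the hypothesis on the negative axis forbid.\<close>

lemma canonical_phases_exist:
  assumes A: "bcirc A \<in> carrier_mat n n" and n: "0 < n" and an: "anisotropic (bcirc A)"
    and neg: "\<And>x. x \<in> carrier_vec n \<Longrightarrow> sesq (bcirc A) x x \<notin> negative_real_axis"
  shows "\<exists>\<phi>. canonical_phases A \<phi>"
proof -
  let ?M = "bcirc A"
  obtain e where e: "\<forall>i<n. e i \<in> carrier_vec n \<and> e i \<noteq> 0\<^sub>v n"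
    "\<forall>i<n. \<forall>k<n. i \<noteq> k \<longrightarrow> sesq ?M (e i) (e k) = 0"
    using sesq_orthogonal_basis[OF A an] by metis
  define \<psi> where "\<psi> k = Arg (sesq ?M (e k) (e k))" for k
  have off: "Im (sesq ?M x x) \<noteq> 0 \<or> 0 < Re (sesq ?M x x)" if "x \<in> carrier_vec n" "x \<noteq> 0\<^sub>v n" for x
    using neg[OF that(1)] anisotropicD[OF an A that]
    by (auto simp: negative_real_axis_def complex_eq_iff not_less)
  have spread: "\<psi> i - \<psi> k < pi" if ik: "i < n" "k < n" for i k
  proof (rule ccontr)
    assume "\<not> \<psi> i - \<psi> k < pi"
    then obtain a b where ab: "0 < a" "0 < b"
      "Im (of_real a * sesq ?M (e i) (e i) + of_real b * sesq ?M (e k) (e k)) = 0"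
      "Re (of_real a * sesq ?M (e i) (e i) + of_real b * sesq ?M (e k) (e k)) \<le> 0"
      using sesq_nonpos_if_phase_spread[OF off off, of "e i" "e k"] e ik by (auto simp: \<psi>_def)
    obtain z where "z \<in> carrier_vec n" "z \<noteq> 0\<^sub>v n"
      "sesq ?M z z = of_real a * sesq ?M (e i) (e i) + of_real b * sesq ?M (e k) (e k)"
      using cone_closed_add[OF A an, of "e i" "e k" a b] e ik ab by auto
    then show False using off[of z] ab(3,4) by auto
  qed
  define ks where "ks = sort_key (\<lambda>k. - \<psi> k) [0..<n]"
  define \<phi> where "\<phi> = map \<psi> ks"
  have ks: "length ks = n" "set ks = {..<n}" "distinct ks" by (auto simp: ks_def)
  have ksn: "ks ! k < n" if "k < n" for k using ks that nth_mem by blast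
  have \<phi>k: "\<phi> ! k = \<psi> (ks ! k)" if "k < n" for k using that ks by (simp add: \<phi>_def)
  have "canonical_phases A \<phi>"
  proof (rule canonical_phases_of_basis[OF A, of "\<lambda>k. e (ks ! k)" "\<lambda>k. cmod (sesq ?M (e (ks ! k)) (e (ks ! k)))"])
    fix k assume k: "k < n"
    show "e (ks ! k) \<in> carrier_vec n" using e ksn[OF k] by blast
    have "sesq ?M (e (ks ! k)) (e (ks ! k)) \<noteq> 0" using anisotropicD[OF an A] e ksn[OF k] by blast
    then show "0 < cmod (sesq ?M (e (ks ! k)) (e (ks ! k))) \<and> sesq ?M (e (ks ! k)) (e (ks ! k)) =
        of_real (cmod (sesq ?M (e (ks ! k)) (e (ks ! k)))) * cis (\<phi> ! k)"
      by (simp add: \<phi>k[OF k] \<psi>_def cis_Arg sgn_div_norm scaleR_conv_of_real)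
  next
    fix i k assume "i < n" "k < n" "i \<noteq> k"
    then show "sesq ?M (e (ks ! i)) (e (ks ! k)) = 0"
      using e(2) ksn ks by (simp add: nth_eq_iff_index_eq)
  next
    show "length \<phi> = n" using ks by (simp add: \<phi>_def)
    show "set \<phi> \<subseteq> {-pi<..pi}" using Arg_bounded by (auto simp: \<phi>_def \<psi>_def)
    have "sorted (map (\<lambda>k. - \<psi> k) ks)" unfolding ks_def by (rule sorted_sort_key)
    then show "sorted_wrt (\<ge>) \<phi>" unfolding \<phi>_def sorted_map sorted_wrt_map by simp
    have "ks \<noteq> []" using ks n by auto
    then show "hd \<phi> - last \<phi> < pi"
      unfolding \<phi>_def using spread ks by (metis hd_in_set hd_map last_in_set last_map lessThan_iff)
  qed
  then show ?thesis by blast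
qed

text \<open>This covers the degenerate limit in which the cone of values is the negative real axis
  itself; all phases are then \<open>pi\<close>, the endpoint that the normalisation
  includes.\<close>

lemma canonical_phases_negative_definite:
  assumes A: "bcirc A \<in> carrier_mat n n" and n: "0 < n"
    and neg: "\<And>x. x \<in> carrier_vec n \<Longrightarrow> x \<noteq> 0\<^sub>v n \<Longrightarrow> sesq (bcirc A) x x \<in> negative_real_axis"
  shows "\<exists>\<phi>. canonical_phases A \<phi>"
proof -
  let ?M = "bcirc A"
  have an: "anisotropic ?M"
    using A neg by (auto simp: anisotropic_def negative_real_axis_def) fastforce
  obtain e where e: "\<forall>i<n. e i \<in> carrier_vec n \<and> e i \<noteq> 0\<^sub>v n"
    "\<forall>i<n. \<forall>k<n. i \<noteq> k \<longrightarrow> sesq ?M (e i) (e k) = 0"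
    using sesq_orthogonal_basis[OF A an] by metis
  have "canonical_phases A (replicate n pi)"
  proof (rule canonical_phases_of_basis[OF A, of e "\<lambda>k. - Re (sesq ?M (e k) (e k))"])
    fix k assume k: "k < n"
    have "sesq ?M (e k) (e k) \<in> negative_real_axis" using neg e k by blast
    then show "0 < - Re (sesq ?M (e k) (e k)) \<and>
      sesq ?M (e k) (e k) = of_real (- Re (sesq ?M (e k) (e k))) * cis (replicate n pi ! k)"
      using k by (auto simp: negative_real_axis_def complex_eq_iff)
  qed (use e n in \<open>auto simp: sorted_wrt_iff_nth_less\<close>)
  then show ?thesis by blast
qed

lemma sesq_conjugate_real:
  assumes A: "A \<in> carrier_mat n n" and x: "x \<in> carrier_vec n"
    and re: "\<And>i j. i < n \<Longrightarrow> j < n \<Longrightarrow> A $$ (i, j) \<in> \<real>"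
  shows "sesq A (conjugate x) (conjugate x) = cnj (sesq A x x)"
  using x re by (auto simp: sesq_sum[OF A] Reals_cnj_iff intro!: sum.cong)

lemma tendsto_sesq:
  assumes A: "A \<in> carrier_mat n n" "\<And>w. B w \<in> carrier_mat n n"
    and lim: "\<And>i j. i < n \<Longrightarrow> j < n \<Longrightarrow> ((\<lambda>w. B w $$ (i, j)) \<longlongrightarrow> A $$ (i, j)) F"
    and x: "x \<in> carrier_vec n" "y \<in> carrier_vec n"
  shows "((\<lambda>w. sesq (B w) x y) \<longlongrightarrow> sesq A x y) F"
  unfolding sesq_sum[OF A(1) x] sesq_sum[OF A(2) x]
  by (intro tendsto_sum tendsto_mult tendsto_const lim) auto

text \<open>The limit itself may violate the hypothesis on the negative real axis, but since it is real,
  its cone is symmetric about the real axis: either it lies in the right half plane, or it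
  degenerates to the negative real axis, because otherwise the cones of nearby values would
  cross that axis.\<close>

lemma canonical_phases_exist_limit:
  assumes A: "bcirc A \<in> carrier_mat n n" and n: "0 < n" and an: "anisotropic (bcirc A)"
    and re: "\<And>i j. i < n \<Longrightarrow> j < n \<Longrightarrow> bcirc A $$ (i, j) \<in> \<real>"
    and B: "\<And>w. B w \<in> carrier_mat n n"
    and lim: "\<And>i j. i < n \<Longrightarrow> j < n \<Longrightarrow> ((\<lambda>w. B w $$ (i, j)) \<longlongrightarrow> bcirc A $$ (i, j)) F"
    and F: "F \<noteq> bot"
    and Ban: "\<forall>\<^sub>F w in F. anisotropic (B w)"
    and Bneg: "\<forall>\<^sub>F w in F. \<forall>x \<in> carrier_vec n. sesq (B w) x x \<notin> negative_real_axis"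
  shows "\<exists>\<phi>. canonical_phases A \<phi>"
proof -
  let ?M = "bcirc A"
  have cnj: "sesq ?M (conjugate x) (conjugate x) = cnj (sesq ?M x x)" if "x \<in> carrier_vec n" for x
    using sesq_conjugate_real[OF A that re] .
  \<comment> \<open>Otherwise the values at \<open>x\<close> and \<open>conjugate x\<close> cancel,
    and by convexity some nonzero vector has value 0.\<close>
  have Re0: "Re (sesq ?M x x) \<noteq> 0" if x: "x \<in> carrier_vec n" "x \<noteq> 0\<^sub>v n" for x
  proof
    assume "Re (sesq ?M x x) = 0"
    then have "of_real 1 * sesq ?M x x + of_real 1 * sesq ?M (conjugate x) (conjugate x) = 0"
      unfolding cnj[OF x(1)] by (simp add: complex_eq_iff)
    moreover obtain z where "z \<in> carrier_vec n" "z \<noteq> 0\<^sub>v n"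
      "sesq ?M z z = of_real 1 * sesq ?M x x + of_real 1 * sesq ?M (conjugate x) (conjugate x)"
      using cone_closed_add[OF A an x, of "conjugate x" 1 1] x by auto
    ultimately show False using anisotropicD[OF an A] by metis
  qed
  show ?thesis
  proof (cases "\<forall>x \<in> carrier_vec n. x \<noteq> 0\<^sub>v n \<longrightarrow> 0 < Re (sesq ?M x x)")
    case True
    have "sesq ?M x x \<notin> negative_real_axis" if "x \<in> carrier_vec n" for x
      using True[rule_format, OF that] A by (cases "x = 0\<^sub>v n") (auto simp: negative_real_axis_def)
    then show ?thesis by (intro canonical_phases_exist[OF A n an]) auto
  next
    case False
    then obtain y where y: "y \<in> carrier_vec n" "y \<noteq> 0\<^sub>v n" "Re (sesq ?M y y) < 0"
      using Re0 by (metis linorder_neqE_linordered_idom)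
    have neg: "Re (sesq ?M x x) < 0" if x: "x \<in> carrier_vec n" "x \<noteq> 0\<^sub>v n" for x
    proof (rule ccontr)
      assume "\<not> Re (sesq ?M x x) < 0"
      then have p: "0 < Re (sesq ?M x x)" using Re0[OF x] by simp
      \<comment> \<open>The weights cancel the two real parts, so the combined value would be purely
        imaginary, which \<open>Re0\<close> excludes.\<close>
      obtain z where "z \<in> carrier_vec n" "z \<noteq> 0\<^sub>v n"
        "sesq ?M z z = of_real (- Re (sesq ?M y y)) * sesq ?M x x + of_real (Re (sesq ?M x x)) * sesq ?M y y"
        using cone_closed_add[OF A an x y(1,2), of "- Re (sesq ?M y y)" "Re (sesq ?M x x)"] p y(3) by auto
      then show False using Re0[of z] by simp
    qed
    have "Im (sesq ?M x x) = 0" if x: "x \<in> carrier_vec n" "x \<noteq> 0\<^sub>v n" for x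
    proof (rule ccontr)
      assume im: "Im (sesq ?M x x) \<noteq> 0"
      let ?x' = "conjugate x"
      have x': "?x' \<in> carrier_vec n" "?x' \<noteq> 0\<^sub>v n" using x by auto
      have l1: "((\<lambda>w. sesq (B w) x x) \<longlongrightarrow> sesq ?M x x) F"
        by (rule tendsto_sesq[OF A B lim x(1) x(1)])
      have l2: "((\<lambda>w. sesq (B w) ?x' ?x') \<longlongrightarrow> cnj (sesq ?M x x)) F"
        unfolding cnj[OF x(1), symmetric] by (rule tendsto_sesq[OF A B lim x'(1) x'(1)])
      have e1: "\<forall>\<^sub>F w in F. Re (sesq (B w) x x) < 0"
        using tendsto_Re[OF l1] neg[OF x] by (rule order_tendstoD(2))
      have e2: "\<forall>\<^sub>F w in F. Re (sesq (B w) ?x' ?x') < 0"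
        using tendsto_Re[OF l2] neg[OF x] by (intro order_tendstoD(2)) auto
      have "((\<lambda>w. Im (sesq (B w) x x) * Im (sesq (B w) ?x' ?x')) \<longlongrightarrow> Im (sesq ?M x x) * Im (cnj (sesq ?M x x))) F"
        by (intro tendsto_mult tendsto_Im l1 l2)
      moreover have "Im (sesq ?M x x) * Im (cnj (sesq ?M x x)) < 0"
        using im by (simp add: zero_less_mult_iff) linarith
      ultimately have e3: "\<forall>\<^sub>F w in F. Im (sesq (B w) x x) * Im (sesq (B w) ?x' ?x') < 0"
        by (rule order_tendstoD(2))
      obtain w where w: "Re (sesq (B w) x x) < 0" "Re (sesq (B w) ?x' ?x') < 0"
        "Im (sesq (B w) x x) * Im (sesq (B w) ?x' ?x') < 0" "anisotropic (B w)"
        "\<forall>x \<in> carrier_vec n. sesq (B w) x x \<notin> negative_real_axis"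
        using eventually_happens'[OF F eventually_conj[OF e1 eventually_conj[OF e2 eventually_conj[OF e3 eventually_conj[OF Ban Bneg]]]]]
        by blast
      let ?u = "sesq (B w) x x" and ?v = "sesq (B w) ?x' ?x'"
      have iuv: "0 < \<bar>Im ?u\<bar>" "0 < \<bar>Im ?v\<bar>" using w(3) by auto
      \<comment> \<open>Near the limit the values at \<open>x\<close> and at its conjugate have
        negative real parts and imaginary parts of opposite sign. These weights cancel the imaginary
        parts, so the combination lands on the negative real axis.\<close>
      obtain z where z: "z \<in> carrier_vec n" "sesq (B w) z z = of_real \<bar>Im ?v\<bar> * ?u + of_real \<bar>Im ?u\<bar> * ?v"
        using cone_closed_add[OF B w(4) x x', of "\<bar>Im ?v\<bar>" "\<bar>Im ?u\<bar>"] iuv by auto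
      have "Im (sesq (B w) z z) = 0" unfolding z using w(3) by (auto simp: abs_if mult_less_0_iff)
      moreover have "Re (sesq (B w) z z) < 0" unfolding z using w(1,2) iuv
        by (simp add: add_neg_neg mult_pos_neg)
      ultimately show False using w(5) z(1) by (auto simp: negative_real_axis_def)
    qed
    then show ?thesis using neg
      by (intro canonical_phases_negative_definite[OF A n]) (auto simp: negative_real_axis_def)
  qed
qed

abbreviation cpoly :: "real poly \<Rightarrow> complex \<Rightarrow> complex" where
  "cpoly q s \<equiv> poly (map_poly of_real q) s"

section \<open>Proper stable rational functions\<close>

interpretation of_real_poly_hom: map_poly_idom_hom "of_real :: real \<Rightarrow> complex" ..

lemma cpoly_mult [simp]: "cpoly (a * b) s = cpoly a s * cpoly b s"
  and cpoly_add [simp]: "cpoly (a + b) s = cpoly a s + cpoly b s"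
  by (simp_all add: of_real_poly_hom.hom_mult of_real_poly_hom.hom_add)

lemma cpoly_cnj: "cpoly a (cnj s) = cnj (cpoly a s)"
  by (rule poly_cnj_real[symmetric]) (simp add: coeff_map_poly)

text \<open>The scalar ring in which all later determinants and inverses live: its elements have no
  pole in the closed right half plane or at infinity.\<close>

definition stable_proper :: "real poly fract set" where
  "stable_proper = {r. rat_proper r \<and> rat_stable r}"

lemma Fract_lowest_terms:
  assumes "b \<noteq> 0"
  obtains c where "c \<noteq> 0" "a = rat_num (Fract a b) * c" "b = rat_den (Fract a b) * c"
proof -
  let ?r = "Fract a b"
  have den: "rat_den ?r \<noteq> 0" by (simp add: rat_den_def)
  have "Fract (rat_num ?r) (rat_den ?r) = ?r" by (simp add: rat_num_def rat_den_def)
  then have eq: "rat_num ?r * b = a * rat_den ?r" using assms den by (simp add: eq_fract)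
  have "coprime (rat_den ?r) (rat_num ?r)"
    unfolding rat_num_def rat_den_def by (simp add: coprime_quot_of_fract coprime_commute)
  moreover have "rat_den ?r dvd rat_num ?r * b" using eq by simp
  ultimately have "rat_den ?r dvd b" by (simp add: coprime_dvd_mult_right_iff)
  then obtain c where c: "b = rat_den ?r * c" ..
  have "rat_den ?r * (rat_num ?r * c) = rat_num ?r * (rat_den ?r * c)" by (simp only: mult_ac)
  also have "rat_den ?r * c = b" by (rule c[symmetric])
  also have "rat_num ?r * b = rat_den ?r * a" using eq by (simp only: mult.commute)
  finally have "rat_den ?r * (rat_num ?r * c) = rat_den ?r * a" .
  then have "rat_num ?r * c = a" using den by simp
  moreover have "c \<noteq> 0" using c assms by auto
  ultimately show ?thesis using that c by metis
qed

lemma rat_value_Fract: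
  assumes "b \<noteq> 0" "cpoly b s \<noteq> 0"
  shows "rat_value (Fract a b) s = cpoly a s / cpoly b s"
proof -
  obtain c where c: "c \<noteq> 0" "a = rat_num (Fract a b) * c" "b = rat_den (Fract a b) * c"
    using Fract_lowest_terms[OF assms(1)] .
  have "cpoly b s = cpoly (rat_den (Fract a b)) s * cpoly c s"
    by (metis c(3) cpoly_mult)
  moreover have "cpoly a s = cpoly (rat_num (Fract a b)) s * cpoly c s"
    by (metis c(2) cpoly_mult)
  ultimately show ?thesis using assms(2) by (simp add: rat_value_def)
qed

text \<open>Sums and products are easier to handle for fractions that need not be in lowest terms.
  Cancelling a common factor only removes zeros of the denominator and lowers both degrees equally,
  so it is enough that some representation passes the test.\<close>

lemma stable_proper_Fract_iff:
  "r \<in> stable_proper \<longleftrightarrow> (\<exists>a b. r = Fract a b \<and> b \<noteq> 0 \<and> degree a \<le> degree b \<and>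
    (\<forall>s. 0 \<le> Re s \<longrightarrow> cpoly b s \<noteq> 0))"
proof
  assume "r \<in> stable_proper"
  then show "\<exists>a b. r = Fract a b \<and> b \<noteq> 0 \<and> degree a \<le> degree b \<and> (\<forall>s. 0 \<le> Re s \<longrightarrow> cpoly b s \<noteq> 0)"
    unfolding stable_proper_def rat_proper_def rat_stable_def
    by (intro exI[of _ "rat_num r"] exI[of _ "rat_den r"])
      (force simp: rat_num_def rat_den_def)
next
  assume "\<exists>a b. r = Fract a b \<and> b \<noteq> 0 \<and> degree a \<le> degree b \<and> (\<forall>s. 0 \<le> Re s \<longrightarrow> cpoly b s \<noteq> 0)"
  then obtain a b where r: "r = Fract a b" "b \<noteq> 0" "degree a \<le> degree b"
    "\<And>s. 0 \<le> Re s \<Longrightarrow> cpoly b s \<noteq> 0" by blast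
  obtain c where c: "c \<noteq> 0" "a = rat_num r * c" "b = rat_den r * c"
    using Fract_lowest_terms[OF r(2)] r(1) by metis
  have den: "rat_den r \<noteq> 0" by (simp add: rat_den_def)
  have "rat_stable r" unfolding rat_stable_def
  proof (intro allI impI)
    fix s assume "cpoly (rat_den r) s = 0"
    then have "cpoly b s = 0" using c(3) by simp
    then show "Re s < 0" using r(4)[of s] by force
  qed
  moreover have "rat_proper r"
  proof (cases "rat_num r = 0")
    case True then show ?thesis by (simp add: rat_proper_def)
  next
    case False
    then show ?thesis using r(3) c(1) den unfolding rat_proper_def c(2) c(3)
      by (simp add: degree_mult_eq)
  qed
  ultimately show "r \<in> stable_proper" by (simp add: stable_proper_def)
qed

lemma stable_properE:
  assumes "r \<in> stable_proper"
  obtains a b where "r = Fract a b" "b \<noteq> 0" "degree a \<le> degree b" "\<And>s. 0 \<le> Re s \<Longrightarrow> cpoly b s \<noteq> 0"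
  using assms unfolding stable_proper_Fract_iff by blast

lemma stable_properI:
  "b \<noteq> 0 \<Longrightarrow> degree a \<le> degree b \<Longrightarrow> (\<And>s. 0 \<le> Re s \<Longrightarrow> cpoly b s \<noteq> 0) \<Longrightarrow> Fract a b \<in> stable_proper"
  unfolding stable_proper_Fract_iff by blast

lemma degree_add_mult_le:
  fixes a b c d :: "real poly"
  assumes "degree a \<le> degree b" "degree c \<le> degree d" "b \<noteq> 0" "d \<noteq> 0"
  shows "degree (a * d + c * b) \<le> degree (b * d)" "degree (a * c) \<le> degree (b * d)"
proof -
  have bd: "degree (b * d) = degree b + degree d" using assms by (simp add: degree_mult_eq)
  have 1: "degree (a * d) \<le> degree (b * d)" unfolding bd using degree_mult_le[of a d] assms by linarith
  have 2: "degree (c * b) \<le> degree (b * d)" unfolding bd using degree_mult_le[of c b] assms by linarith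
  show "degree (a * d + c * b) \<le> degree (b * d)" using 1 2 by (rule degree_add_le)
  show "degree (a * c) \<le> degree (b * d)" unfolding bd using degree_mult_le[of a c] assms by linarith
qed

lemma
  assumes "q \<in> stable_proper" "r \<in> stable_proper"
  shows stable_proper_add: "q + r \<in> stable_proper"
    and stable_proper_mult: "q * r \<in> stable_proper"
    and rat_value_add: "0 \<le> Re s \<Longrightarrow> rat_value (q + r) s = rat_value q s + rat_value r s"
    and rat_value_mult: "0 \<le> Re s \<Longrightarrow> rat_value (q * r) s = rat_value q s * rat_value r s"
proof -
  obtain a b where q: "q = Fract a b" "b \<noteq> 0" "degree a \<le> degree b" "\<And>s. 0 \<le> Re s \<Longrightarrow> cpoly b s \<noteq> 0"
    using stable_properE[OF assms(1)] by blast
  obtain c d where r: "r = Fract c d" "d \<noteq> 0" "degree c \<le> degree d" "\<And>s. 0 \<le> Re s \<Longrightarrow> cpoly d s \<noteq> 0"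
    using stable_properE[OF assms(2)] by blast
  have add: "q + r = Fract (a * d + c * b) (b * d)" and mult: "q * r = Fract (a * c) (b * d)"
    unfolding q(1) r(1) using q(2) r(2) by simp_all
  have bd: "b * d \<noteq> 0" "\<And>s. 0 \<le> Re s \<Longrightarrow> cpoly (b * d) s \<noteq> 0"
    using q(2) r(2) q(4) r(4) by simp_all
  show "q + r \<in> stable_proper" "q * r \<in> stable_proper"
    unfolding add mult using bd
    by (intro stable_properI degree_add_mult_le[OF q(3) r(3) q(2) r(2)]; blast)+
  assume s: "0 \<le> Re s"
  show "rat_value (q + r) s = rat_value q s + rat_value r s"
    unfolding add rat_value_Fract[OF bd(1) bd(2)[OF s]]
    unfolding q(1) r(1) rat_value_Fract[OF q(2) q(4)[OF s]] rat_value_Fract[OF r(2) r(4)[OF s]]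
    cpoly_add cpoly_mult by (rule add_frac_eq[OF q(4)[OF s] r(4)[OF s], symmetric])
  show "rat_value (q * r) s = rat_value q s * rat_value r s"
    unfolding mult rat_value_Fract[OF bd(1) bd(2)[OF s]]
    unfolding q(1) r(1) rat_value_Fract[OF q(2) q(4)[OF s]] rat_value_Fract[OF r(2) r(4)[OF s]]
    unfolding cpoly_mult times_divide_times_eq ..
qed

lemma rat_value_1 [simp]: "rat_value 1 s = 1"
  by (simp add: rat_value_def rat_num_def rat_den_def)

lemma stable_proper_1: "1 \<in> stable_proper" "- 1 \<in> stable_proper"
proof -
  show "1 \<in> stable_proper" by (simp add: stable_proper_def rat_proper_def rat_stable_def rat_num_def rat_den_def)
  have "(- 1 :: real poly fract) = Fract (- 1) 1" by (simp add: One_fract_def)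
  also have "\<dots> \<in> stable_proper" by (rule stable_properI) auto
  finally show "- 1 \<in> stable_proper" .
qed

text \<open>The limit is taken in all complex directions, while \<open>rat_freq\<close> follows the
  imaginary axis; the wider limit gives continuity at the point of the disc that represents
  infinity.\<close>

definition rat_inf :: "real poly fract \<Rightarrow> complex" where
  "rat_inf r = Lim at_infinity (rat_value r)"

text \<open>After division by \<open>s ^ degree b\<close> both polynomials have finite limits; the
  coefficient of \<open>a\<close> at \<open>degree b\<close> is 0 when the quotient is strictly
  proper.\<close>

lemma tendsto_cpoly_quotient:
  assumes "b \<noteq> 0" "degree a \<le> degree b"
  shows "((\<lambda>s. cpoly a s / cpoly b s) \<longlongrightarrow> of_real (coeff a (degree b) / lead_coeff b)) at_infinity"
proof -
  let ?n = "degree b"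
  have db: "degree (map_poly complex_of_real b) = ?n" "lead_coeff (map_poly complex_of_real b) = of_real (lead_coeff b)"
    by (simp_all add: of_real_hom.degree_map_poly_hom)
  have b: "((\<lambda>s. cpoly b s / s ^ ?n) \<longlongrightarrow> of_real (lead_coeff b)) at_infinity"
    using poly_divide_tendsto_aux[of "map_poly complex_of_real b"] unfolding db by simp
  have a: "((\<lambda>s. cpoly a s / s ^ ?n) \<longlongrightarrow> of_real (coeff a ?n)) at_infinity"
  proof (cases "degree a = ?n")
    case True
    then show ?thesis
      using poly_divide_tendsto_aux[of "map_poly complex_of_real a"] by (simp add: of_real_hom.degree_map_poly_hom coeff_map_poly)
  next
    case False
    then have lt: "degree a < ?n" using assms by simp
    have "((\<lambda>s. cpoly a s / poly (monom 1 ?n) s) \<longlongrightarrow> 0) at_infinity"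
      by (rule poly_divide_tendsto_0_at_infinity) (simp add: of_real_hom.degree_map_poly_hom degree_monom_eq lt)
    then show ?thesis using lt by (simp add: poly_monom coeff_eq_0)
  qed
  have "((\<lambda>s. (cpoly a s / s ^ ?n) / (cpoly b s / s ^ ?n)) \<longlongrightarrow> of_real (coeff a ?n) / of_real (lead_coeff b)) at_infinity"
    using assms by (intro tendsto_divide a b) auto
  moreover have "\<forall>\<^sub>F s in at_infinity. (cpoly a s / s ^ ?n) / (cpoly b s / s ^ ?n) = cpoly a s / cpoly b s"
    using eventually_not_equal_at_infinity[of 0] by eventually_elim auto
  ultimately show ?thesis by (simp add: Lim_transform_eventually)
qed

lemma tendsto_rat_value_infinity:
  assumes "b \<noteq> 0" "degree a \<le> degree b"
  shows "(rat_value (Fract a b) \<longlongrightarrow> of_real (coeff a (degree b) / lead_coeff b)) at_infinity"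
proof -
  \<comment> \<open>The quotient and the reduced value are known to agree only off the zeros of
    \<open>b\<close>; these are finitely many, hence avoided near infinity.\<close>
  have "finite {s. cpoly b s = 0}"
    by (rule poly_roots_finite) (use assms in auto)
  then have "bounded {s. cpoly b s = 0}" by (rule finite_imp_bounded)
  then obtain K where K: "\<And>s. cpoly b s = 0 \<Longrightarrow> norm s \<le> K" unfolding bounded_iff by auto
  have "\<forall>\<^sub>F s in at_infinity. K + 1 \<le> norm (s :: complex)"
    unfolding eventually_at_infinity by blast
  then have "\<forall>\<^sub>F s in at_infinity. cpoly a s / cpoly b s = rat_value (Fract a b) s"
  proof eventually_elim
    case (elim s)
    then have "cpoly b s \<noteq> 0" using K[of s] by force
    then show ?case using rat_value_Fract[OF assms(1)] by simp
  qed
  then show ?thesis using tendsto_cpoly_quotient[OF assms] by (rule Lim_transform_eventually[rotated])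
qed

lemma rat_inf_Fract:
  assumes "b \<noteq> 0" "degree a \<le> degree b"
  shows "rat_inf (Fract a b) = of_real (coeff a (degree b) / lead_coeff b)"
  unfolding rat_inf_def using tendsto_rat_value_infinity[OF assms] by (intro tendsto_Lim trivial_limit_at_infinity)

lemma
  assumes "r \<in> stable_proper"
  shows tendsto_rat_inf: "(rat_value r \<longlongrightarrow> rat_inf r) at_infinity"
    and rat_inf_real: "rat_inf r \<in> \<real>"
proof -
  obtain a b where r: "r = Fract a b" "b \<noteq> 0" "degree a \<le> degree b" "\<And>s. 0 \<le> Re s \<Longrightarrow> cpoly b s \<noteq> 0"
    using stable_properE[OF assms] by blast
  show "(rat_value r \<longlongrightarrow> rat_inf r) at_infinity" "rat_inf r \<in> \<real>"
    unfolding r(1) rat_inf_Fract[OF r(2,3)] by (rule tendsto_rat_value_infinity[OF r(2,3)] Reals_of_real)+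
qed

lemma filterlim_mult_of_real_at_infinity:
  assumes "c \<noteq> 0"
  shows "filterlim (\<lambda>w. c * complex_of_real w) at_infinity at_top"
proof (rule filterlim_norm_at_top_imp_at_infinity)
  show "filterlim (\<lambda>w. norm (c * complex_of_real w)) at_top at_top"
    unfolding norm_mult norm_of_real using assms
    by (intro filterlim_tendsto_pos_mult_at_top[OF tendsto_const] filterlim_abs_real) auto
qed

text \<open>Arithmetic identities for values are available only for nonnegative real part, so the
  limits are compared along the positive real axis.\<close>

lemma rat_inf_eqI:
  assumes "r \<in> stable_proper" "(f \<longlongrightarrow> L) at_infinity" "\<And>s. 0 \<le> Re s \<Longrightarrow> rat_value r s = f s"
  shows "rat_inf r = L"
proof -
  note inf = filterlim_mult_of_real_at_infinity[of 1, simplified]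
  have "((\<lambda>w. rat_value r (of_real w)) \<longlongrightarrow> rat_inf r) at_top"
    by (rule filterlim_compose[OF tendsto_rat_inf[OF assms(1)] inf])
  moreover have "\<forall>\<^sub>F w in at_top. rat_value r (of_real w) = f (of_real w)"
    using eventually_ge_at_top[of "0 :: real"] by eventually_elim (simp add: assms(3))
  ultimately have "((\<lambda>w. f (of_real w)) \<longlongrightarrow> rat_inf r) at_top"
    by (rule Lim_transform_eventually)
  then show ?thesis
    using filterlim_compose[OF assms(2) inf] by (rule tendsto_unique[OF trivial_limit_at_top_linorder])
qed

lemma
  assumes "q \<in> stable_proper" "r \<in> stable_proper"
  shows rat_inf_add: "rat_inf (q + r) = rat_inf q + rat_inf r"
    and rat_inf_mult: "rat_inf (q * r) = rat_inf q * rat_inf r"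
  by (rule rat_inf_eqI[OF stable_proper_add[OF assms] tendsto_add[OF assms[THEN tendsto_rat_inf]]],
      erule rat_value_add[OF assms],
    rule rat_inf_eqI[OF stable_proper_mult[OF assms] tendsto_mult[OF assms[THEN tendsto_rat_inf]]],
      erule rat_value_mult[OF assms])

lemma rat_inf_1: "rat_inf 1 = 1"
  by (rule rat_inf_eqI[OF stable_proper_1(1) tendsto_const]) simp

text \<open>Absence of zeros in the closed right half plane makes the reciprocal stable; a nonzero
  value at infinity forces equal degrees, which makes it proper.\<close>

lemma stable_proper_inverse:
  assumes r: "r \<in> stable_proper" and nz: "\<And>s. 0 \<le> Re s \<Longrightarrow> rat_value r s \<noteq> 0" and inf: "rat_inf r \<noteq> 0"
  shows "r \<noteq> 0" "inverse r \<in> stable_proper"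
proof -
  obtain a b where ab: "r = Fract a b" "b \<noteq> 0" "degree a \<le> degree b" "\<And>s. 0 \<le> Re s \<Longrightarrow> cpoly b s \<noteq> 0"
    using stable_properE[OF r] by blast
  have lc: "coeff a (degree b) \<noteq> 0" using inf unfolding ab(1) rat_inf_Fract[OF ab(2,3)] by auto
  then have deg: "degree b \<le> degree a" by (rule le_degree)
  have a0: "a \<noteq> 0" using lc by auto
  have "cpoly a s \<noteq> 0" if "0 \<le> Re s" for s
    using nz[OF that] unfolding ab(1) rat_value_Fract[OF ab(2) ab(4)[OF that]] by auto
  then have "Fract b a \<in> stable_proper" using a0 deg by (intro stable_properI) auto
  then show "inverse r \<in> stable_proper" by (simp add: ab(1))
  show "r \<noteq> 0" using a0 ab(2) by (simp add: ab(1) Zero_fract_def eq_fract)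
qed

lemma rat_value_cnj: "rat_value r (cnj s) = cnj (rat_value r s)"
  by (simp add: rat_value_def cpoly_cnj)

lemma
  assumes "r \<in> stable_proper"
  shows holomorphic_rat_value: "rat_value r holomorphic_on {s. 0 < Re s}"
    and isCont_rat_value: "0 \<le> Re s \<Longrightarrow> isCont (rat_value r) s"
proof -
  have nz: "cpoly (rat_den r) s \<noteq> 0" if "0 \<le> Re s" for s
    using assms that unfolding stable_proper_def rat_stable_def by force
  show "rat_value r holomorphic_on {s. 0 < Re s}" unfolding rat_value_def
    by (intro holomorphic_intros) (use nz in \<open>auto intro: less_imp_le\<close>)
  show "isCont (rat_value r) s" if "0 \<le> Re s" unfolding rat_value_def
    by (intro continuous_intros) (use nz[OF that] in auto)
qed

lemma rat_freq_real [simp]: "rat_freq r (ereal w) = rat_value r (\<i> * of_real w)"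
  by (simp add: rat_freq_def)

lemma
  assumes "r \<in> stable_proper"
  shows tendsto_rat_freq: "((\<lambda>w. rat_freq r (ereal w)) \<longlongrightarrow> rat_inf r) at_top"
    and rat_freq_infinity: "rat_freq r \<infinity> = rat_inf r"
proof -
  have "((\<lambda>w :: real. rat_value r (\<i> * of_real w)) \<longlongrightarrow> rat_inf r) at_top"
    by (rule filterlim_compose[OF tendsto_rat_inf[OF assms] filterlim_mult_of_real_at_infinity]) simp
  then show "((\<lambda>w. rat_freq r (ereal w)) \<longlongrightarrow> rat_inf r) at_top" "rat_freq r \<infinity> = rat_inf r"
    by (simp_all add: rat_freq_def tendsto_Lim)
qed

section \<open>Determinants and inverses under homomorphisms defined on a subring\<close>

lemma elements_mat_subsetD:
  assumes "A \<in> carrier_mat n k" "elements_mat A \<subseteq> R" "i < n" "j < k"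
  shows "A $$ (i, j) \<in> R"
  using assms by (blast intro: elements_matI)

lemma times_mat_index:
  assumes "A \<in> carrier_mat n k" "B \<in> carrier_mat k l" "i < n" "j < l"
  shows "(A * B) $$ (i, j) = (\<Sum>q = 0..<k. A $$ (i, q) * B $$ (q, j))"
  using assms by (auto simp: scalar_prod_def intro!: sum.cong)

text \<open>\<open>rat_value\<close> is 0 at a pole by division by zero, so evaluation respects sums
  and products only for functions that are regular at the point. The homomorphism laws are therefore
  required on the subring \<open>R\<close> alone, and each transfer result also has to show that its
  ingredients stay in \<open>R\<close>.\<close>

locale partial_ring_hom =
  fixes R :: "'a :: comm_ring_1 set" and h :: "'a \<Rightarrow> 'b :: comm_ring_1"
  assumes one_in: "1 \<in> R" and minus_one_in: "- 1 \<in> R"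
    and add_in: "x \<in> R \<Longrightarrow> y \<in> R \<Longrightarrow> x + y \<in> R"
    and mult_in: "x \<in> R \<Longrightarrow> y \<in> R \<Longrightarrow> x * y \<in> R"
    and h_one: "h 1 = 1"
    and h_add: "x \<in> R \<Longrightarrow> y \<in> R \<Longrightarrow> h (x + y) = h x + h y"
    and h_mult: "x \<in> R \<Longrightarrow> y \<in> R \<Longrightarrow> h (x * y) = h x * h y"
begin

lemma zero_in: "0 \<in> R"
  using add_in[OF one_in minus_one_in] by simp

lemma h_zero: "h 0 = 0"
  using h_add[OF zero_in zero_in] by simp

lemma h_minus_one: "h (- 1) = - 1"
  using h_add[OF one_in minus_one_in] by (simp add: h_zero h_one eq_neg_iff_add_eq_0 add.commute)

lemma
  assumes "\<And>i. i \<in> I \<Longrightarrow> f i \<in> R"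
  shows sum_in: "sum f I \<in> R" and h_sum: "h (sum f I) = (\<Sum>i\<in>I. h (f i))"
proof -
  have "sum f I \<in> R \<and> h (sum f I) = (\<Sum>i\<in>I. h (f i))" using assms
    by (induction I rule: infinite_finite_induct) (auto simp: zero_in h_zero add_in h_add)
  then show "sum f I \<in> R" "h (sum f I) = (\<Sum>i\<in>I. h (f i))" by auto
qed

lemma
  assumes "\<And>i. i \<in> I \<Longrightarrow> f i \<in> R"
  shows prod_in: "prod f I \<in> R" and h_prod: "h (prod f I) = (\<Prod>i\<in>I. h (f i))"
proof -
  have "prod f I \<in> R \<and> h (prod f I) = (\<Prod>i\<in>I. h (f i))" using assms
    by (induction I rule: infinite_finite_induct) (auto simp: one_in h_one mult_in h_mult)
  then show "prod f I \<in> R" "h (prod f I) = (\<Prod>i\<in>I. h (f i))" by auto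
qed

lemma
  assumes A: "A \<in> carrier_mat n n" "elements_mat A \<subseteq> R"
  shows det_in: "det A \<in> R" and h_det: "h (det A) = det (map_mat h A)"
proof -
  have el: "A $$ (i, j) \<in> R" if "i < n" "j < n" for i j using elements_mat_subsetD[OF A that] .
  have per: "p i < n" if "p permutes {0..<n}" "i < n" for p i
    using that permutes_in_image[of p "{0..<n}" i] by auto
  have sg: "signof p \<in> R \<and> h (signof p) = signof p" for p :: "nat \<Rightarrow> nat"
    by (cases "evenperm p") (auto simp: sign_def one_in minus_one_in h_one h_minus_one)
  have pr: "(\<Prod>i=0..<n. A $$ (i, p i)) \<in> R" "h (\<Prod>i=0..<n. A $$ (i, p i)) = (\<Prod>i=0..<n. h (A $$ (i, p i)))"
    if "p permutes {0..<n}" for p using el per[OF that] by (auto intro!: prod_in h_prod)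
  have d: "det A = (\<Sum>p | p permutes {0..<n}. signof p * (\<Prod>i=0..<n. A $$ (i, p i)))"
    using det_def'[OF A(1)] .
  show "det A \<in> R" unfolding d using sg pr by (auto intro!: sum_in mult_in)
  have "h (det A) = (\<Sum>p | p permutes {0..<n}. signof p * (\<Prod>i=0..<n. h (A $$ (i, p i))))"
    unfolding d using sg pr by (subst h_sum) (auto intro!: mult_in sum.cong simp: h_mult)
  also have "\<dots> = det (map_mat h A)"
    using A per by (subst det_def'[of _ n]) (auto intro!: sum.cong prod.cong)
  finally show "h (det A) = det (map_mat h A)" .
qed

lemma
  assumes A: "A \<in> carrier_mat n k" "elements_mat A \<subseteq> R" and B: "B \<in> carrier_mat k l" "elements_mat B \<subseteq> R"
  shows mult_mat_in: "elements_mat (A * B) \<subseteq> R" and h_mult_mat: "map_mat h (A * B) = map_mat h A * map_mat h B"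
proof -
  have a: "A $$ (i, j) \<in> R" if "i < n" "j < k" for i j using elements_mat_subsetD[OF A that] .
  have b: "B $$ (i, j) \<in> R" if "i < k" "j < l" for i j using elements_mat_subsetD[OF B that] .
  note eq = times_mat_index[OF A(1) B(1)]
  show "elements_mat (A * B) \<subseteq> R"
    using A B a b by (auto simp: elements_mat_def eq simp del: index_mult_mat(1) intro!: sum_in mult_in)
  show "map_mat h (A * B) = map_mat h A * map_mat h B"
  proof (rule eq_matI)
    fix i j assume "i < dim_row (map_mat h A * map_mat h B)" "j < dim_col (map_mat h A * map_mat h B)"
    then have ij: "i < n" "j < l" using A B by auto
    have "map_mat h (A * B) $$ (i, j) = h ((A * B) $$ (i, j))" using ij A B by simp
    also have "\<dots> = (\<Sum>q = 0..<k. h (A $$ (i, q)) * h (B $$ (q, j)))"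
      unfolding eq[OF ij] using a b ij by (subst h_sum) (auto intro!: mult_in sum.cong simp: h_mult)
    also have "\<dots> = (map_mat h A * map_mat h B) $$ (i, j)"
      using A B ij by (auto simp: scalar_prod_def intro!: sum.cong)
    finally show "map_mat h (A * B) $$ (i, j) = (map_mat h A * map_mat h B) $$ (i, j)" .
  qed (use A B in auto)
qed

lemma
  assumes A: "A \<in> carrier_mat n k" "elements_mat A \<subseteq> R" and B: "B \<in> carrier_mat n k" "elements_mat B \<subseteq> R"
  shows add_mat_in: "elements_mat (A + B) \<subseteq> R" and h_add_mat: "map_mat h (A + B) = map_mat h A + map_mat h B"
proof -
  have a: "A $$ (i, j) \<in> R" if "i < n" "j < k" for i j using elements_mat_subsetD[OF A that] .
  have b: "B $$ (i, j) \<in> R" if "i < n" "j < k" for i j using elements_mat_subsetD[OF B that] .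
  show "elements_mat (A + B) \<subseteq> R"
    using A B a b by (auto simp: elements_mat_def intro!: add_in)
  show "map_mat h (A + B) = map_mat h A + map_mat h B"
    using A B a b by (intro eq_matI) (auto simp: h_add)
qed

lemma
  shows one_mat_in: "elements_mat (1\<^sub>m n) \<subseteq> R" and h_one_mat: "map_mat h (1\<^sub>m n) = 1\<^sub>m n"
  by (auto simp: elements_mat_def one_in zero_in h_one h_zero intro!: eq_matI)

end

text \<open>Cofactors are signed determinants of submatrices and stay in \<open>R\<close>; with an
  inverse \<open>c\<close> of the determinant in \<open>R\<close>, the multiple of the adjugate by
  \<open>c\<close> is an inverse over \<open>R\<close>.\<close>

lemma (in partial_ring_hom) inverse_mat_in:
  assumes A: "A \<in> carrier_mat n n" "elements_mat A \<subseteq> R"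
    and c: "c \<in> R" "c * det A = 1"
  shows "\<exists>B \<in> carrier_mat n n. elements_mat B \<subseteq> R \<and> A * B = 1\<^sub>m n \<and> B * A = 1\<^sub>m n"
proof (intro bexI conjI)
  let ?B = "c \<cdot>\<^sub>m adj_mat A"
  note adj = adj_mat[OF A(1)]
  show B: "?B \<in> carrier_mat n n" using adj(1) by simp
  have "A * ?B = c \<cdot>\<^sub>m (A * adj_mat A)" using A(1) adj(1) by (simp add: mult_smult_distrib)
  then show "A * ?B = 1\<^sub>m n" unfolding adj(2) using c(2) by (auto intro!: eq_matI)
  have "?B * A = c \<cdot>\<^sub>m (adj_mat A * A)" using A(1) adj(1) by (simp add: mult_smult_assoc_mat)
  then show "?B * A = 1\<^sub>m n" unfolding adj(3) using c(2) by (auto intro!: eq_matI)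
  have el: "A $$ (i, j) \<in> R" if "i < n" "j < n" for i j using elements_mat_subsetD[OF A that] .
  have "cofactor A j i \<in> R" if ij: "i < n" "j < n" for i j
  proof -
    have md: "mat_delete A j i \<in> carrier_mat (n - 1) (n - 1)" using A(1) by (intro carrier_matI) (auto simp: mat_delete_def)
    have "elements_mat (mat_delete A j i) \<subseteq> R"
      using A(1) el ij by (auto simp: elements_mat_def mat_delete_def)
    then have d: "det (mat_delete A j i) \<in> R" by (rule det_in[OF md])
    have "(- 1) ^ k \<in> R" for k :: nat by (induction k) (auto simp: one_in intro: mult_in[OF minus_one_in, simplified])
    then show ?thesis unfolding cofactor_def using d by (intro mult_in)
  qed
  then show "elements_mat ?B \<subseteq> R"
    using A(1) c(1) by (auto simp: elements_mat_def adj_mat_def intro!: mult_in)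
qed

section \<open>Block-circulant matrices of tensors\<close>

lemma carrier_tensorD:
  assumes "A \<in> carrier_tensor m n p"
  shows "length A = p" "k < p \<Longrightarrow> A ! k \<in> carrier_mat m n"
  using assms by (auto simp: carrier_tensor_def)

lemma carrier_tensor_dims:
  assumes "A \<in> carrier_tensor m n p" "0 < p"
  shows "dim_row (A ! 0) = m" "dim_col (A ! 0) = n" "length A = p"
  using carrier_tensorD[OF assms(1)] assms(2) by auto

lemma bcirc_carrier: "A \<in> carrier_tensor m n p \<Longrightarrow> 0 < p \<Longrightarrow> bcirc A \<in> carrier_mat (m * p) (n * p)"
  unfolding bcirc_def Let_def by (simp add: carrier_tensor_dims)

lemma bcirc_index:
  assumes "A \<in> carrier_tensor m n p" "i < m * p" "j < n * p"
  shows "bcirc A $$ (i, j) = (A ! ((i div m + (p - j div n)) mod p)) $$ (i mod m, j mod n)"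
proof -
  have "0 < p" using assms(2) by (cases p) auto
  then show ?thesis using assms unfolding bcirc_def Let_def by (simp add: carrier_tensor_dims)
qed

lemma block_index:
  fixes m p :: nat
  assumes "i < m * p"
  shows "i div m < p" "i mod m < m"
proof -
  have "0 < m" using assms by (cases m) auto
  then show "i div m < p" "i mod m < m" using assms by (simp_all add: less_mult_imp_div_less mult.commute)
qed

lemma block_compose:
  fixes m p :: nat
  assumes "i < m" "k < p"
  shows "k * m + i < m * p" "(k * m + i) div m = k" "(k * m + i) mod m = i"
proof -
  have "k * m + i < Suc k * m" using assms by simp
  also have "\<dots> \<le> p * m" using assms by (intro mult_le_mono1) simp
  finally show "k * m + i < m * p" by (simp add: mult.commute)
qed (use assms in auto)

lemma bcirc_first_column:
  assumes A: "A \<in> carrier_tensor m n p" and ij: "i < m" "j < n" and k: "k < p"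
  shows "bcirc A $$ (k * m + i, j) = (A ! k) $$ (i, j)"
proof -
  have "j < n * p" using ij k by (cases p) auto
  then show ?thesis
    using bcirc_index[OF A block_compose(1)[OF ij(1) k]] block_compose(2,3)[OF ij(1) k] ij k by simp
qed

text \<open>The first block column lists the slices and so determines the tensor.\<close>

lemma bcirc_inject:
  assumes "A \<in> carrier_tensor m n p" "B \<in> carrier_tensor m n p" "bcirc A = bcirc B"
  shows "A = B"
proof (rule nth_equalityI)
  fix k assume "k < length A"
  then have k: "k < p" using assms carrier_tensorD by metis
  show "A ! k = B ! k"
    using carrier_tensorD(2)[OF assms(1) k] carrier_tensorD(2)[OF assms(2) k]
      bcirc_first_column[OF assms(1) _ _ k] bcirc_first_column[OF assms(2) _ _ k] assms(3)
    by (intro eq_matI) auto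
qed (use assms carrier_tensorD in metis)

lemma sum_blocks:
  fixes f :: "nat \<Rightarrow> 'a :: comm_monoid_add" and m p :: nat
  shows "(\<Sum>q = 0..<m * p. f q) = (\<Sum>r = 0..<p. \<Sum>i = 0..<m. f (r * m + i))"
proof (induction p)
  case (Suc p)
  have "(\<Sum>q = 0..<m * Suc p. f q) = (\<Sum>q = 0..<m * p. f q) + (\<Sum>q = m * p..<m * p + m. f q)"
    by (simp add: sum.atLeastLessThan_concat add.commute)
  also have "(\<Sum>q = m * p..<m * p + m. f q) = (\<Sum>i = 0..<m. f (p * m + i))"
    using sum.shift_bounds_nat_ivl[of f 0 "m * p" m] by (simp add: add.commute mult.commute)
  finally show ?case using Suc by simp
qed simp

lemma tfold_carrier: "M \<in> carrier_mat (m * p) n \<Longrightarrow> 0 < p \<Longrightarrow> tfold p M \<in> carrier_tensor m n p"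
  by (auto simp: tfold_def carrier_tensor_def Let_def)

lemma tfold_index:
  assumes "M \<in> carrier_mat (m * p) n" "k < p" "i < m" "j < n"
  shows "(tfold p M ! k) $$ (i, j) = M $$ (k * m + i, j)"
  using assms by (auto simp: tfold_def Let_def)

lemma tunfold_carrier: "A \<in> carrier_tensor m n p \<Longrightarrow> 0 < p \<Longrightarrow> tunfold A \<in> carrier_mat (m * p) n"
  unfolding tunfold_def Let_def by (simp add: carrier_tensor_dims)

lemma tunfold_index:
  assumes "A \<in> carrier_tensor m n p" "r < p" "i < m" "j < n"
  shows "tunfold A $$ (r * m + i, j) = (A ! r) $$ (i, j)"
  using assms block_compose[OF assms(3,2)] unfolding tunfold_def Let_def
  by (simp add: carrier_tensor_dims)

lemma tfold_tunfold:
  assumes "A \<in> carrier_tensor m n p" "0 < p"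
  shows "tfold p (tunfold A) = A"
proof (rule nth_equalityI)
  have c: "tfold p (tunfold A) \<in> carrier_tensor m n p"
    using tfold_carrier[OF tunfold_carrier[OF assms] assms(2)] .
  show "length (tfold p (tunfold A)) = length A" using carrier_tensorD(1)[OF c] carrier_tensorD(1)[OF assms(1)] by simp
  fix k assume "k < length (tfold p (tunfold A))"
  then have k: "k < p" using carrier_tensorD(1)[OF c] by simp
  show "tfold p (tunfold A) ! k = A ! k"
    using carrier_tensorD(2)[OF c k] carrier_tensorD(2)[OF assms(1) k]
      tfold_index[OF tunfold_carrier[OF assms] k] tunfold_index[OF assms(1) k]
    by (intro eq_matI) auto
qed

lemma tprod_carrier:
  assumes "A \<in> carrier_tensor m n p" "B \<in> carrier_tensor n q p" "0 < p"
  shows "A \<star>\<^sub>T B \<in> carrier_tensor m q p"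
  unfolding tprod_def carrier_tensorD(1)[OF assms(1)]
  using bcirc_carrier[OF assms(1,3)] tunfold_carrier[OF assms(2,3)] assms(3) by (intro tfold_carrier) auto

text \<open>Block indices are residues modulo \<open>p\<close>, with \<open>a + (p - b)\<close>
  encoding a difference; over the integers the identity is
  \<open>a - b - c = a - (b + c)\<close>.\<close>

lemma mod_sub_shift:
  fixes p a b c :: nat
  assumes "a < p" "b < p" "c < p"
  shows "((a + (p - b)) mod p + (p - c)) mod p = (a + (p - (b + c) mod p)) mod p"
proof -
  have sub: "int ((x + (p - y)) mod p) = (int x - int y) mod int p" if "y \<le> p" for x y
  proof -
    have "int (x + (p - y)) = int x - int y + int p" using that by simp
    then show ?thesis by (simp only: zmod_int mod_add_self2)
  qed
  have "int (((a + (p - b)) mod p + (p - c)) mod p) = (int a - int b - int c) mod int p"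
    unfolding sub[OF less_imp_le[OF assms(3)]] sub[OF less_imp_le[OF assms(2)]] by (rule mod_diff_left_eq)
  moreover have "int ((a + (p - (b + c) mod p)) mod p) = (int a - int b - int c) mod int p"
    using assms by (subst sub) (simp_all add: zmod_int mod_diff_right_eq diff_diff_eq less_imp_le)
  ultimately show ?thesis by simp
qed

text \<open>Both sides are cyclic convolutions of the slices. The T-product sums over the slices of
  \<open>B\<close>, the matrix product over the block columns of \<open>bcirc A\<close>; a cyclic
  shift of the summation index matches them.\<close>

lemma bcirc_tprod:
  fixes A B :: "'a :: semiring_0 tensor"
  assumes A: "A \<in> carrier_tensor m n p" and B: "B \<in> carrier_tensor n q p" and p: "0 < p"
  shows "bcirc (A \<star>\<^sub>T B) = bcirc A * bcirc B"
proof (rule eq_matI)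
  note AB = tprod_carrier[OF A B p]
  note cA = bcirc_carrier[OF A p] and cB = bcirc_carrier[OF B p] and cAB = bcirc_carrier[OF AB p]
  show "dim_row (bcirc (A \<star>\<^sub>T B)) = dim_row (bcirc A * bcirc B)"
    "dim_col (bcirc (A \<star>\<^sub>T B)) = dim_col (bcirc A * bcirc B)" using cA cB cAB by auto
  fix i j assume "i < dim_row (bcirc A * bcirc B)" "j < dim_col (bcirc A * bcirc B)"
  then have ij: "i < m * p" "j < q * p" using cA cB by auto
  let ?I = "i div m" and ?J = "j div q" and ?i = "i mod m" and ?j = "j mod q"
  note bi = block_index[OF ij(1)] and bj = block_index[OF ij(2)]
  let ?d = "\<lambda>a b. (a + (p - b)) mod p"
  have dlt: "?d a b < p" for a b using p by simp
  let ?f = "\<lambda>r. \<Sum>l = 0..<n. (A ! ?d (?d ?I ?J) r) $$ (?i, l) * (B ! r) $$ (l, ?j)"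
  let ?k = "?d ?I ?J"
  have "bcirc (A \<star>\<^sub>T B) $$ (i, j) = ((A \<star>\<^sub>T B) ! ?k) $$ (?i, ?j)"
    by (rule bcirc_index[OF AB ij])
  also have "\<dots> = (bcirc A * tunfold B) $$ (?k * m + ?i, ?j)"
    unfolding tprod_def carrier_tensorD(1)[OF A] using cA tunfold_carrier[OF B p] bi bj dlt
    by (intro tfold_index) auto
  also have "\<dots> = (\<Sum>s = 0..<n * p. bcirc A $$ (?k * m + ?i, s) * tunfold B $$ (s, ?j))"
    by (rule times_mat_index[OF cA tunfold_carrier[OF B p] block_compose(1)[OF bi(2) dlt] bj(2)])
  also have "\<dots> = (\<Sum>r = 0..<p. ?f r)"
    unfolding sum_blocks
  proof (intro sum.cong refl)
    fix r l assume "r \<in> {0..<p}" "l \<in> {0..<n}"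
    then have rl: "r < p" "l < n" by auto
    show "bcirc A $$ (?k * m + ?i, r * n + l) * tunfold B $$ (r * n + l, ?j)
        = (A ! ?d ?k r) $$ (?i, l) * (B ! r) $$ (l, ?j)"
      using bcirc_index[OF A block_compose(1)[OF bi(2) dlt] block_compose(1)[OF rl(2,1)]]
        block_compose(2,3)[OF bi(2) dlt] block_compose(2,3)[OF rl(2,1)] tunfold_index[OF B rl bj(2)] by simp
  qed
  also have "\<dots> = (\<Sum>r = 0..<p. ?f (?d r ?J))"
  proof (rule sum.reindex_bij_betw[symmetric])
    have "inj_on (\<lambda>r. ?d r ?J) {0..<p}"
    proof (rule inj_onI)
      fix a b assume ab: "a \<in> {0..<p}" "b \<in> {0..<p}" "?d a ?J = ?d b ?J"
      then have "(?d a ?J + ?J) mod p = (?d b ?J + ?J) mod p" by simp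
      then have "(a + p) mod p = (b + p) mod p" using bj(1)
        by (metis add.assoc le_add_diff_inverse2 less_imp_le mod_add_left_eq)
      then show "a = b" using ab by simp
    qed
    moreover have "(\<lambda>r. ?d r ?J) ` {0..<p} \<subseteq> {0..<p}" using p by auto
    ultimately show "bij_betw (\<lambda>r. ?d r ?J) {0..<p} {0..<p}"
      by (simp add: bij_betw_def endo_inj_surj)
  qed
  also have "\<dots> = (\<Sum>r = 0..<p. \<Sum>l = 0..<n. bcirc A $$ (i, r * n + l) * bcirc B $$ (r * n + l, j))"
  proof (intro sum.cong refl)
    fix r l assume "r \<in> {0..<p}" "l \<in> {0..<n}"
    then have rl: "r < p" "l < n" by auto
    \<comment> \<open>In residues: \<open>(I - J) - (r - J) = I - r\<close>.\<close>
    have "?d ?k (?d r ?J) = ?d ?I r"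
    proof -
      have "?d ?k (?d r ?J) = ?d ?I ((?J + ?d r ?J) mod p)" by (rule mod_sub_shift[OF bi(1) bj(1) dlt])
      also have "(?J + ?d r ?J) mod p = r"
        using bj(1) rl by (simp add: mod_add_right_eq)
      finally show ?thesis .
    qed
    then show "(A ! ?d ?k (?d r ?J)) $$ (?i, l) * (B ! ?d r ?J) $$ (l, ?j)
        = bcirc A $$ (i, r * n + l) * bcirc B $$ (r * n + l, j)"
      using bcirc_index[OF A ij(1) block_compose(1)[OF rl(2,1)]] bcirc_index[OF B block_compose(1)[OF rl(2,1)] ij(2)]
        block_compose(2,3)[OF rl(2,1)] by simp
  qed
  also have "\<dots> = (bcirc A * bcirc B) $$ (i, j)"
    unfolding times_mat_index[OF cA cB ij] sum_blocks ..
  finally show "bcirc (A \<star>\<^sub>T B) $$ (i, j) = (bcirc A * bcirc B) $$ (i, j)" .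
qed

lemma tplus_carrier:
  assumes "A \<in> carrier_tensor m n p" "B \<in> carrier_tensor m n p"
  shows "A +\<^sub>T B \<in> carrier_tensor m n p"
  using assms by (auto simp: carrier_tensor_def tplus_def set_zip) (metis add_carrier_mat nth_mem subsetD)+

lemma bcirc_tplus:
  assumes A: "A \<in> carrier_tensor m n p" and B: "B \<in> carrier_tensor m n p" and p: "0 < p"
  shows "bcirc (A +\<^sub>T B) = bcirc A + bcirc B"
proof (rule eq_matI)
  note AB = tplus_carrier[OF A B]
  note c = bcirc_carrier[OF A p] bcirc_carrier[OF B p] bcirc_carrier[OF AB p]
  show "dim_row (bcirc (A +\<^sub>T B)) = dim_row (bcirc A + bcirc B)"
    "dim_col (bcirc (A +\<^sub>T B)) = dim_col (bcirc A + bcirc B)" using c by auto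
  fix i j assume "i < dim_row (bcirc A + bcirc B)" "j < dim_col (bcirc A + bcirc B)"
  then have ij: "i < m * p" "j < n * p" using c by auto
  define k where "k = (i div m + (p - j div n)) mod p"
  have k: "k < p" using p by (simp add: k_def)
  have nth: "(A +\<^sub>T B) ! k = A ! k + B ! k"
    using carrier_tensorD(1)[OF A] carrier_tensorD(1)[OF B] k by (simp add: tplus_def)
  show "bcirc (A +\<^sub>T B) $$ (i, j) = (bcirc A + bcirc B) $$ (i, j)"
    using bcirc_index[OF A ij, folded k_def] bcirc_index[OF B ij, folded k_def] bcirc_index[OF AB ij, folded k_def] c ij
      carrier_tensorD(2)[OF A k] carrier_tensorD(2)[OF B k] block_index[OF ij(1)] block_index[OF ij(2)]
    by (simp add: nth)
qed

lemma tid_carrier: "tid m p \<in> carrier_tensor m m p"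
  by (auto simp: carrier_tensor_def tid_def)

lemma is_tinverse_iff:
  assumes A: "(A :: 'a :: ring_1 tensor) \<in> carrier_tensor m m p" and mp: "0 < m" "0 < p"
  shows "is_tinverse A B \<longleftrightarrow> B \<in> carrier_tensor m m p \<and>
    bcirc A * bcirc B = 1\<^sub>m (m * p) \<and> bcirc B * bcirc A = 1\<^sub>m (m * p)"
proof -
  have eq: "X \<star>\<^sub>T Y = tid m p \<longleftrightarrow> bcirc X * bcirc Y = 1\<^sub>m (m * p)"
    if X: "X \<in> carrier_tensor m m p" and Y: "Y \<in> carrier_tensor m m p" for X Y :: "'a tensor"
    using bcirc_inject[OF tprod_carrier[OF X Y mp(2)] tid_carrier] bcirc_tprod[OF X Y mp(2)] bcirc_tid[OF mp]
    by metis
  show ?thesis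
    unfolding is_tinverse_def Let_def carrier_tensor_dims[OF A mp(2)] using eq[OF A] eq[OF _ A] by blast
qed

text \<open>The candidate is the tensor whose unfolding is the first block column of the matrix inverse;
  no prior knowledge that the inverse is block circulant is needed.\<close>

lemma is_tinverse_exists:
  assumes A: "(A :: 'a :: ring_1 tensor) \<in> carrier_tensor m m p" and mp: "0 < m" "0 < p"
    and X: "X \<in> carrier_mat (m * p) (m * p)" "bcirc A * X = 1\<^sub>m (m * p)" "X * bcirc A = 1\<^sub>m (m * p)"
  shows "\<exists>B. is_tinverse A B \<and> bcirc B = X"
proof -
  define B where "B = tfold p (X * tunfold (tid m p))"
  have I: "tunfold (tid m p :: 'a tensor) \<in> carrier_mat (m * p) m" by (rule tunfold_carrier[OF tid_carrier mp(2)])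
  have XI: "X * tunfold (tid m p) \<in> carrier_mat (m * p) m" using X(1) I by simp
  have B: "B \<in> carrier_tensor m m p" unfolding B_def by (rule tfold_carrier[OF XI mp(2)])
  note cA = bcirc_carrier[OF A mp(2)] and cB = bcirc_carrier[OF B mp(2)]
  have uB: "tunfold B = X * tunfold (tid m p)"
  proof (rule eq_matI)
    fix i j assume "i < dim_row (X * tunfold (tid m p))" "j < dim_col (X * tunfold (tid m p))"
    then have ij: "i < m * p" "j < m" using XI by auto
    note bi = block_index[OF ij(1)]
    have i: "i div m * m + i mod m = i" by simp
    show "tunfold B $$ (i, j) = (X * tunfold (tid m p)) $$ (i, j)"
      using tunfold_index[OF B bi ij(2)] tfold_index[OF XI bi ij(2)] unfolding i B_def by simp
  qed (use tunfold_carrier[OF B mp(2)] XI in auto)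
  have "A \<star>\<^sub>T B = tfold p (bcirc A * X * tunfold (tid m p))"
    unfolding tprod_def carrier_tensorD(1)[OF A] uB assoc_mult_mat[OF cA X(1) I] ..
  also have "\<dots> = tid m p"
    unfolding X(2) left_mult_one_mat[OF I] by (rule tfold_tunfold[OF tid_carrier mp(2)])
  finally have AB: "bcirc A * bcirc B = 1\<^sub>m (m * p)"
    using bcirc_tprod[OF A B mp(2)] bcirc_tid[OF mp] by metis
  \<comment> \<open>Multiplication of the one-sided identity by \<open>X\<close> identifies
    \<open>bcirc B\<close> with \<open>X\<close>; this is where the matrix inverse turns out to be
    block circulant.\<close>
  have "X * (bcirc A * bcirc B) = bcirc B"
    unfolding assoc_mult_mat[OF X(1) cA cB, symmetric] X(3) by (rule left_mult_one_mat[OF cB])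
  then have "bcirc B = X" unfolding AB right_mult_one_mat[OF X(1)] ..
  then show ?thesis using B AB X(3) is_tinverse_iff[OF A mp] by auto
qed

text \<open>Uniqueness of matrix inverses and injectivity of \<open>bcirc\<close> make the definite
  description in \<open>tinv\<close> meaningful.\<close>

lemma tinv_eqI:
  assumes A: "(A :: 'a :: ring_1 tensor) \<in> carrier_tensor m m p" and mp: "0 < m" "0 < p" and B: "is_tinverse A B"
  shows "tinv A = B"
  unfolding tinv_def
proof (rule the_equality)
  show "is_tinverse A B" by (rule B)
  fix C assume C: "is_tinverse A C"
  note b = B[unfolded is_tinverse_iff[OF A mp]] and c = C[unfolded is_tinverse_iff[OF A mp]]
  note cA = bcirc_carrier[OF A mp(2)]
  have cB: "bcirc B \<in> carrier_mat (m * p) (m * p)" and cC: "bcirc C \<in> carrier_mat (m * p) (m * p)"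
    using b c bcirc_carrier mp(2) by blast+
  have "bcirc C = bcirc C * bcirc A * bcirc B"
    using b assoc_mult_mat[OF cC cA cB] right_mult_one_mat[OF cC] by simp
  also have "\<dots> = bcirc B" using c left_mult_one_mat[OF cB] by simp
  finally show "C = B" using b c bcirc_inject by blast
qed

section \<open>From the imaginary axis to the right half plane\<close>

text \<open>The minimum modulus principle turns "no zeros in the disc" into a lower bound that depends
  only on the boundary values, so the property propagates along \<open>t\<close> in steps of fixed size.\<close>

lemma disc_nonvanishing_homotopy:
  fixes f :: "real \<Rightarrow> complex \<Rightarrow> complex"
  assumes cont: "continuous_on ({0..1} \<times> cball 0 1) (\<lambda>(t, w). f t w)"
    and hol: "\<And>t. t \<in> {0..1} \<Longrightarrow> f t holomorphic_on ball 0 1"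
    and bdry: "\<And>t w. t \<in> {0..1} \<Longrightarrow> norm w = 1 \<Longrightarrow> f t w \<noteq> 0"
    and start: "\<And>w. norm w \<le> 1 \<Longrightarrow> f 0 w \<noteq> 0"
    and w: "norm w \<le> 1"
  shows "f 1 w \<noteq> 0"
proof -
  have cpt: "compact ({0..1 :: real} \<times> sphere (0 :: complex) 1)" by (intro compact_Times) auto
  have ne: "{0..1 :: real} \<times> sphere (0 :: complex) 1 \<noteq> {}" by auto
  have "continuous_on ({0..1} \<times> sphere 0 1) (\<lambda>x. norm (case x of (t, w) \<Rightarrow> f t w))"
    by (intro continuous_on_norm continuous_on_subset[OF cont]) auto
  then obtain x where x: "x \<in> {0..1} \<times> sphere 0 1"
    "\<forall>y \<in> {0..1} \<times> sphere 0 1. norm (case x of (t, w) \<Rightarrow> f t w) \<le> norm (case y of (t, w) \<Rightarrow> f t w)"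
    using continuous_attains_inf[OF cpt ne] by blast
  \<comment> \<open>The minimum of the modulus over all \<open>t\<close> and the whole circle:
    positive, since it is attained, and independent of \<open>t\<close>.\<close>
  define c where "c = norm (case x of (t, w) \<Rightarrow> f t w)"
  have c: "0 < c" using x(1) bdry by (auto simp: c_def)
  have low: "c \<le> norm (f t w)" if "t \<in> {0..1}" "norm w = 1" for t w
    using x(2)[rule_format, of "(t, w)"] that by (simp add: c_def)
  have cont_t: "continuous_on (cball 0 1) (f t)" if "t \<in> {0..1}" for t
  proof -
    have "continuous_on (cball 0 1) ((\<lambda>(t, w). f t w) \<circ> (\<lambda>w. (t, w)))"
      using that by (intro continuous_on_compose continuous_on_subset[OF cont] continuous_intros) auto
    then show ?thesis by (simp add: o_def)
  qed
  \<comment> \<open>Maximum modulus principle for the reciprocal, which is holomorphic as long as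
    the disc contains no zero.\<close>
  have minmod: "c \<le> norm (f t w)"
    if t: "t \<in> {0..1}" and nz: "\<And>w. norm w \<le> 1 \<Longrightarrow> f t w \<noteq> 0" and w: "norm w \<le> 1" for t w
  proof -
    have "norm (inverse (f t w)) \<le> inverse c"
    proof (rule maximum_modulus_frontier[of "\<lambda>w. inverse (f t w)" "cball 0 1"])
      show "(\<lambda>w. inverse (f t w)) holomorphic_on interior (cball 0 1)"
        using nz by (intro holomorphic_on_inverse) (auto intro: hol[OF t])
      show "continuous_on (closure (cball 0 1)) (\<lambda>w. inverse (f t w))"
        using nz by (intro continuous_on_inverse) (auto intro: cont_t[OF t])
      fix z :: complex assume "z \<in> frontier (cball 0 1)"
      then show "norm (inverse (f t z)) \<le> inverse c"
        using low[OF t, of z] c by (simp add: norm_inverse le_imp_inverse_le)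
    qed (use w in auto)
    then show ?thesis using c nz[OF w] by (simp add: norm_inverse)
  qed
  have "uniformly_continuous_on ({0..1} \<times> cball 0 1) (\<lambda>(t, w). f t w)"
    by (intro compact_uniformly_continuous[OF cont] compact_Times) auto
  then obtain \<delta> where \<delta>: "0 < \<delta>"
    "\<And>x y. x \<in> {0..1} \<times> cball 0 1 \<Longrightarrow> y \<in> {0..1} \<times> cball 0 1 \<Longrightarrow> dist y x < \<delta> \<Longrightarrow>
      dist (case y of (t, w) \<Rightarrow> f t w) (case x of (t, w) \<Rightarrow> f t w) < c"
    using c unfolding uniformly_continuous_on_def by metis
  \<comment> \<open>A step of \<open>1 / N\<close> in \<open>t\<close> changes values by less than
    \<open>c\<close>, so a function bounded below by \<open>c\<close> in modulus cannot acquire a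
    zero within one step.\<close>
  obtain N :: nat where N: "0 < N" "1 / N < \<delta>"
    using real_arch_inverse[of \<delta>] \<delta>(1) by (auto simp: inverse_eq_divide)
  have "norm w \<le> 1 \<Longrightarrow> f (k / N) w \<noteq> 0" if "k \<le> N" for k :: nat and w
    using that
  proof (induction k arbitrary: w)
    case 0
    then show ?case using start by simp
  next
    case (Suc k)
    have t: "k / N \<in> {0..1}" "Suc k / N \<in> {0..1}" using Suc.prems N by auto
    have "dist (f (Suc k / N) w) (f (k / N) w) < c"
    proof -
      have "dist (Suc k / N, w) (k / N, w) = \<bar>Suc k / N - k / N\<bar>" by (simp add: dist_Pair_Pair dist_real_def)
      also have "\<dots> = 1 / N" using N by (simp flip: diff_divide_distrib)
      finally show ?thesis using \<delta>(2)[of "(k / N, w)" "(Suc k / N, w)"] N t Suc.prems by simp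
    qed
    moreover have "c \<le> norm (f (k / N) w)" using Suc by (intro minmod[OF t(1)]) auto
    ultimately show ?case by (auto simp: dist_norm)
  qed
  from this[of N w] show ?thesis using N w by simp
qed

section \<open>Transfer functions on the unit disc\<close>

text \<open>The Cayley transform maps the closed unit disc without 1 onto the closed right half
  plane, the circle going to the imaginary axis and 1 to infinity. Nonvanishing up to infinity thus
  becomes a statement on a compact set.\<close>

definition disc_value :: "real poly fract \<Rightarrow> complex \<Rightarrow> complex" where
  "disc_value r w = (if w = 1 then rat_inf r else rat_value r ((1 + w) / (1 - w)))"

lemma Re_cayley:
  assumes "w \<noteq> 1"
  shows "Re ((1 + w) / (1 - w)) = (1 - (norm w)\<^sup>2) / (norm (1 - w))\<^sup>2"
proof -
  have "Re ((1 + w) / (1 - w)) = Re ((1 + w) * cnj (1 - w)) / (norm (1 - w))\<^sup>2"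
    by (subst complex_div_cnj) (simp flip: of_real_power)
  also have "Re ((1 + w) * cnj (1 - w)) = 1 - (norm w)\<^sup>2"
    unfolding cmod_power2 by (simp add: algebra_simps power2_eq_square)
  finally show ?thesis .
qed

lemma Re_cayley_nonneg:
  assumes "w \<noteq> 1" "norm w \<le> 1"
  shows "0 \<le> Re ((1 + w) / (1 - w))"
  unfolding Re_cayley[OF assms(1)] using assms(2) by (simp add: abs_square_le_1)

lemma Re_cayley_pos:
  assumes "norm w < 1"
  shows "0 < Re ((1 + w) / (1 - w))"
proof -
  have "w \<noteq> 1" using assms by auto
  moreover have "(norm w)\<^sup>2 < 1" using assms by (simp add: abs_square_less_1)
  ultimately show ?thesis by (simp add: Re_cayley)
qed

lemma cayley_surj:
  assumes "0 \<le> Re s"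
  obtains w where "w \<noteq> 1" "norm w \<le> 1" "s = (1 + w) / (1 - w)"
proof
  let ?w = "(s - 1) / (s + 1)"
  have nz: "s + 1 \<noteq> 0" using assms by (auto simp: complex_eq_iff)
  show "?w \<noteq> 1" using nz by (simp add: divide_eq_eq) 
  have "1 + ?w = 2 * s / (s + 1)" "1 - ?w = 2 / (s + 1)" using nz by (simp_all add: field_simps)
  then show "s = (1 + ?w) / (1 - ?w)" using nz by simp
  have "(norm (s - 1))\<^sup>2 \<le> (norm (s + 1))\<^sup>2"
    unfolding cmod_power2 using assms by (simp add: power2_eq_square algebra_simps)
  then have "norm (s - 1) \<le> norm (s + 1)" by (rule power2_le_imp_le) simp
  then show "norm ?w \<le> 1" using nz by (simp add: norm_divide divide_le_eq)
qed

lemma partial_ring_hom_rat_value: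
  assumes "0 \<le> Re s"
  shows "partial_ring_hom stable_proper (\<lambda>r. rat_value r s)"
  by unfold_locales (auto simp: stable_proper_1 stable_proper_add stable_proper_mult rat_value_add rat_value_mult assms)

lemma partial_ring_hom_rat_inf: "partial_ring_hom stable_proper rat_inf"
  by unfold_locales (auto simp: stable_proper_1 stable_proper_add stable_proper_mult rat_inf_add rat_inf_mult rat_inf_1)

lemma partial_ring_hom_disc_value:
  assumes "norm w \<le> 1"
  shows "partial_ring_hom stable_proper (\<lambda>r. disc_value r w)"
  using partial_ring_hom_rat_value[OF Re_cayley_nonneg[OF _ assms]] partial_ring_hom_rat_inf
  by (cases "w = 1") (auto simp: disc_value_def)

lemma isCont_disc_value:
  assumes r: "r \<in> stable_proper" and w: "norm w \<le> 1"
  shows "isCont (disc_value r) w"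
proof (cases "w = 1")
  case True
  have lim: "filterlim (\<lambda>w. (1 + w) / (1 - w)) at_infinity (at (1 :: complex))"
  proof (rule filterlim_divide_at_infinity)
    show "((\<lambda>w. 1 + w) \<longlongrightarrow> (2 :: complex)) (at 1)" by (auto intro!: tendsto_eq_intros)
    show "filterlim (\<lambda>w. 1 - w) (at 0) (at (1 :: complex))"
      by (rule filterlim_atI) (auto intro!: tendsto_eq_intros simp: eventually_at_filter)
  qed auto
  have "((\<lambda>w. rat_value r ((1 + w) / (1 - w))) \<longlongrightarrow> rat_inf r) (at 1)"
    by (rule filterlim_compose[OF tendsto_rat_inf[OF r] lim])
  moreover have "\<forall>\<^sub>F w in at 1. rat_value r ((1 + w) / (1 - w)) = disc_value r w"
    by (simp add: eventually_at_filter disc_value_def)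
  ultimately have "(disc_value r \<longlongrightarrow> rat_inf r) (at 1)" by (rule Lim_transform_eventually)
  then show ?thesis by (simp add: True isCont_def disc_value_def)
next
  case False
  have "isCont (\<lambda>w. rat_value r ((1 + w) / (1 - w))) w"
    by (rule isCont_o2[where f = "\<lambda>w. (1 + w) / (1 - w)" and g = "rat_value r", OF _ isCont_rat_value[OF r Re_cayley_nonneg[OF False w]]])
      (use False in \<open>auto intro!: continuous_intros\<close>)
  moreover have "\<forall>\<^sub>F w in nhds w. rat_value r ((1 + w) / (1 - w)) = disc_value r w"
    using t1_space_nhds[OF False] by eventually_elim (simp add: disc_value_def)
  ultimately show ?thesis using isCont_cong by metis
qed

lemma holomorphic_disc_value:
  assumes r: "r \<in> stable_proper"
  shows "disc_value r holomorphic_on ball 0 1"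
proof -
  have "(rat_value r \<circ> (\<lambda>w. (1 + w) / (1 - w))) holomorphic_on ball 0 1"
    by (rule holomorphic_on_compose_gen[OF _ holomorphic_rat_value[OF r]])
      (auto intro!: holomorphic_intros Re_cayley_pos)
  then show ?thesis
    by (rule holomorphic_transform) (auto simp: disc_value_def)
qed

text \<open>The circle covers both halves of the imaginary axis, the hypotheses only nonnegative
  frequencies; real coefficients make the value at a negative frequency the conjugate of the value
  at its mirror image. One frequency serves all functions, so the result applies entrywise to
  matrices.\<close>

lemma disc_value_boundary:
  assumes "norm w = 1"
  obtains \<omega> :: ereal where "0 \<le> \<omega>" "\<forall>r \<in> stable_proper. disc_value r w = rat_freq r \<omega>"
  | \<omega> :: ereal where "0 \<le> \<omega>" "\<forall>r \<in> stable_proper. disc_value r w = cnj (rat_freq r \<omega>)"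
proof (cases "w = 1")
  case True
  show ?thesis by (rule that(1)[of \<infinity>]) (auto simp: True disc_value_def rat_freq_infinity)
next
  case False
  define s where "s = (1 + w) / (1 - w)"
  have "Re s = 0" unfolding s_def Re_cayley[OF False] assms by simp
  then have s: "s = \<i> * of_real (Im s)" by (simp add: complex_eq_iff)
  have dv: "disc_value r w = rat_value r s" for r using False by (simp add: disc_value_def s_def)
  show ?thesis
  proof (cases "0 \<le> Im s")
    case True
    then show ?thesis using s by (intro that(1)[of "ereal (Im s)"]) (auto simp: dv)
  next
    case False
    have "s = cnj (\<i> * of_real (- Im s))" using \<open>Re s = 0\<close> by (simp add: complex_eq_iff)
    then have "rat_value r s = cnj (rat_value r (\<i> * of_real (- Im s)))" for r
      unfolding rat_value_cnj[symmetric] by (rule arg_cong)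
    then show ?thesis using False
      by (intro that(2)[of "ereal (- Im s)"]) (auto simp: dv)
  qed
qed

text \<open>The Leibniz expansion reduces continuity and holomorphy of the determinant to those of
  the entries.\<close>

lemma det_one_plus_smult:
  fixes P :: "'a :: comm_ring_1 mat"
  assumes "P \<in> carrier_mat n n"
  shows "det (1\<^sub>m n + t \<cdot>\<^sub>m P) = (\<Sum>p | p permutes {0..<n}. signof p *
    (\<Prod>i = 0..<n. (if i = p i then 1 else 0) + t * P $$ (i, p i)))"
proof -
  have "p i < n" if "p permutes {0..<n}" "i < n" for p i
    using that permutes_in_image[of p "{0..<n}" i] by auto
  then show ?thesis using assms by (subst det_def'[of _ n]) (auto intro!: sum.cong prod.cong)
qed

lemma
  assumes P: "P \<in> carrier_mat n n" "elements_mat P \<subseteq> stable_proper"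
  shows continuous_on_det_disc:
      "continuous_on (T \<times> cball 0 1) (\<lambda>(t, w). det (1\<^sub>m n + of_real t \<cdot>\<^sub>m map_mat (\<lambda>r. disc_value r w) P))"
    and holomorphic_det_disc:
      "(\<lambda>w. det (1\<^sub>m n + c \<cdot>\<^sub>m map_mat (\<lambda>r. disc_value r w) P)) holomorphic_on ball 0 1"
proof -
  have el: "P $$ (i, p i) \<in> stable_proper" if "p permutes {0..<n}" "i < n" for p i
    using that permutes_in_image[of p "{0..<n}" i] by (intro elements_mat_subsetD[OF P]) auto
  have d: "det (1\<^sub>m n + c \<cdot>\<^sub>m map_mat (\<lambda>r. disc_value r w) P) = (\<Sum>p | p permutes {0..<n}. signof p *
    (\<Prod>i = 0..<n. (if i = p i then 1 else 0) + c * disc_value (P $$ (i, p i)) w))" for c w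
  proof -
    have "p i < n" if "p permutes {0..<n}" "i < n" for p i
      using that permutes_in_image[of p "{0..<n}" i] by auto
    then show ?thesis using P(1) by (subst det_one_plus_smult) (auto intro!: sum.cong prod.cong)
  qed
  have c: "continuous_on (T \<times> cball 0 1) (\<lambda>x. disc_value r (snd x))" if "r \<in> stable_proper" for r
    by (rule continuous_on_compose2[of "cball 0 1" "disc_value r"])
      (auto intro!: continuous_intros continuous_at_imp_continuous_on isCont_disc_value[OF that])
  show "continuous_on (T \<times> cball 0 1) (\<lambda>(t, w). det (1\<^sub>m n + of_real t \<cdot>\<^sub>m map_mat (\<lambda>r. disc_value r w) P))"
    unfolding d case_prod_beta
    by (intro continuous_intros c) (auto intro: el)
  show "(\<lambda>w. det (1\<^sub>m n + c \<cdot>\<^sub>m map_mat (\<lambda>r. disc_value r w) P)) holomorphic_on ball 0 1"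
    unfolding d by (intro holomorphic_intros holomorphic_disc_value) (auto intro: el)
qed

text \<open>The homotopy parameter scales complex matrices after evaluation. At \<open>t = 1\<close>
  the scaled matrix is the evaluation of a rational one; evaluation commutes with the determinant,
  and nonvanishing on the disc becomes the criterion for a rational function to be a unit.\<close>

lemma det_return_difference_unit:
  assumes P: "P \<in> carrier_mat n n" "elements_mat P \<subseteq> stable_proper"
    and nz: "\<And>t \<omega>. t \<in> {0..1} \<Longrightarrow> 0 \<le> \<omega> \<Longrightarrow>
      det (1\<^sub>m n + complex_of_real t \<cdot>\<^sub>m map_mat (\<lambda>r. rat_freq r \<omega>) P) \<noteq> 0"
  shows "det (1\<^sub>m n + P) \<noteq> 0" "inverse (det (1\<^sub>m n + P)) \<in> stable_proper"
proof -
  define f where "f t w = det (1\<^sub>m n + complex_of_real t \<cdot>\<^sub>m map_mat (\<lambda>r. disc_value r w) P)" for t w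
  have bdry: "f t w \<noteq> 0" if t: "t \<in> {0..1}" and w: "norm w = 1" for t w
    using w
  proof (cases rule: disc_value_boundary)
    case (1 \<omega>)
    have "map_mat (\<lambda>r. disc_value r w) P = map_mat (\<lambda>r. rat_freq r \<omega>) P"
      using 1(2) P(1) elements_mat_subsetD[OF P] by (intro eq_matI) auto
    then show ?thesis using nz[OF t 1(1)] by (simp add: f_def)
  next
    case (2 \<omega>)
    \<comment> \<open>Conjugation is a ring homomorphism on all complex numbers, so it passes
      through the determinant; this settles negative frequencies.\<close>
    interpret cnj: partial_ring_hom UNIV cnj by unfold_locales auto
    have "1\<^sub>m n + complex_of_real t \<cdot>\<^sub>m map_mat (\<lambda>r. disc_value r w) P
        = map_mat cnj (1\<^sub>m n + complex_of_real t \<cdot>\<^sub>m map_mat (\<lambda>r. rat_freq r \<omega>) P)"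
      using 2(2) P(1) elements_mat_subsetD[OF P] by (intro eq_matI) auto
    then have "f t w = cnj (det (1\<^sub>m n + complex_of_real t \<cdot>\<^sub>m map_mat (\<lambda>r. rat_freq r \<omega>) P))"
      unfolding f_def using P(1) by (subst cnj.h_det[of _ n]) auto
    then show ?thesis using nz[OF t 2(1)] by simp
  qed
  have disc: "f 1 w \<noteq> 0" if "norm w \<le> 1" for w
  proof (rule disc_nonvanishing_homotopy[OF _ _ bdry _ that])
    show "continuous_on ({0..1} \<times> cball 0 1) (\<lambda>(t, w). f t w)"
      unfolding f_def by (rule continuous_on_det_disc[OF P])
    show "f t holomorphic_on ball 0 1" for t
      unfolding f_def by (rule holomorphic_det_disc[OF P])
    show "f 0 w \<noteq> 0" for w
    proof -
      have "1\<^sub>m n + complex_of_real 0 \<cdot>\<^sub>m map_mat (\<lambda>r. disc_value r w) P = 1\<^sub>m n"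
        using P(1) by (intro eq_matI) auto
      then show ?thesis by (simp add: f_def)
    qed
  qed
  interpret inf: partial_ring_hom stable_proper rat_inf by (rule partial_ring_hom_rat_inf)
  have IP: "1\<^sub>m n + P \<in> carrier_mat n n" "elements_mat (1\<^sub>m n + P) \<subseteq> stable_proper"
    using P inf.add_mat_in[OF one_carrier_mat inf.one_mat_in P] by auto
  have val: "disc_value (det (1\<^sub>m n + P)) w \<noteq> 0" if w: "norm w \<le> 1" for w
  proof -
    interpret h: partial_ring_hom stable_proper "\<lambda>r. disc_value r w" by (rule partial_ring_hom_disc_value[OF w])
    have "disc_value (det (1\<^sub>m n + P)) w = det (1\<^sub>m n + map_mat (\<lambda>r. disc_value r w) P)"
      unfolding h.h_det[OF IP] h.h_add_mat[OF one_carrier_mat h.one_mat_in P] h.h_one_mat ..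
    also have "\<dots> = f 1 w"
    proof -
      have "1\<^sub>m n + map_mat (\<lambda>r. disc_value r w) P = 1\<^sub>m n + complex_of_real 1 \<cdot>\<^sub>m map_mat (\<lambda>r. disc_value r w) P"
        using P(1) by (intro eq_matI) auto
      then show ?thesis by (simp add: f_def)
    qed
    finally show ?thesis using disc[OF w] by simp
  qed
  have "rat_value (det (1\<^sub>m n + P)) s \<noteq> 0" if s: "0 \<le> Re s" for s
  proof -
    obtain w where w: "w \<noteq> 1" "norm w \<le> 1" "s = (1 + w) / (1 - w)" using cayley_surj[OF s] .
    then show ?thesis using val[OF w(2)] by (simp add: disc_value_def)
  qed
  moreover have "rat_inf (det (1\<^sub>m n + P)) \<noteq> 0" using val[of 1] by (simp add: disc_value_def)
  ultimately show "det (1\<^sub>m n + P) \<noteq> 0" "inverse (det (1\<^sub>m n + P)) \<in> stable_proper"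
    using stable_proper_inverse[OF inf.det_in[OF IP]] by blast+
qed

section \<open>Stability of the feedback system\<close>

lemma RH_inf_tensor_iff:
  assumes "0 < p"
  shows "A \<in> RH_inf_tensor m p \<longleftrightarrow> A \<in> carrier_tensor m m p \<and> elements_mat (bcirc A) \<subseteq> stable_proper"
proof
  assume A: "A \<in> RH_inf_tensor m p"
  then have c: "A \<in> carrier_tensor m m p" by (simp add: RH_inf_tensor_def)
  moreover have "bcirc A $$ (i, j) \<in> stable_proper" if "i < m * p" "j < m * p" for i j
    using A that by (simp add: RH_inf_tensor_def RH_inf_def stable_proper_def)
  then have "elements_mat (bcirc A) \<subseteq> stable_proper"
    using bcirc_carrier[OF c assms] by (auto simp: elements_mat_def)
  ultimately show "A \<in> carrier_tensor m m p \<and> elements_mat (bcirc A) \<subseteq> stable_proper" by blast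
next
  assume "A \<in> carrier_tensor m m p \<and> elements_mat (bcirc A) \<subseteq> stable_proper"
  then have A: "A \<in> carrier_tensor m m p" "elements_mat (bcirc A) \<subseteq> stable_proper" by simp_all
  note c = bcirc_carrier[OF A(1) assms]
  show "A \<in> RH_inf_tensor m p"
    using A(1) c elements_mat_subsetD[OF c A(2)] by (simp add: RH_inf_tensor_def RH_inf_def stable_proper_def)
qed

lemma slice_in_stable_proper:
  assumes "A \<in> carrier_tensor m n p" "elements_mat (bcirc A) \<subseteq> stable_proper" "k < p" "i < m" "j < n"
  shows "(A ! k) $$ (i, j) \<in> stable_proper"
proof -
  have p: "0 < p" using assms by simp
  have "j < n * p" using assms(3,5) by (cases p) auto
  then have "bcirc A $$ (k * m + i, j) \<in> stable_proper"
    by (rule elements_mat_subsetD[OF bcirc_carrier[OF assms(1) p] assms(2) block_compose(1)[OF assms(4,3)]])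
  then show ?thesis unfolding bcirc_first_column[OF assms(1,4,5,3)] .
qed

lemma bcirc_elements:
  assumes A: "A \<in> carrier_tensor m n p" and "0 < p"
    and el: "\<And>k i j. k < p \<Longrightarrow> i < m \<Longrightarrow> j < n \<Longrightarrow> (A ! k) $$ (i, j) \<in> R"
  shows "elements_mat (bcirc A) \<subseteq> R"
proof
  fix a assume "a \<in> elements_mat (bcirc A)"
  then obtain i j where ij: "i < m * p" "j < n * p" "a = bcirc A $$ (i, j)"
    using bcirc_carrier[OF assms(1,2)] by (auto simp: elements_mat_def)
  show "a \<in> R" unfolding ij(3) bcirc_index[OF A ij(1,2)]
    using block_index[OF ij(1)] block_index[OF ij(2)] assms(2) by (intro el) auto
qed

text \<open>Entries of a block-circulant matrix are entries of slices, and the blocks are assembled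
  slice by slice, so membership can be checked on slices.\<close>

lemma tblock_in_RH_inf_tensor:
  assumes p: "0 < p" and "A \<in> RH_inf_tensor m p" "B \<in> RH_inf_tensor m p" "C \<in> RH_inf_tensor m p" "D \<in> RH_inf_tensor m p"
  shows "tblock A B C D \<in> RH_inf_tensor (2 * m) p"
proof -
  have X: "X \<in> carrier_tensor m m p" "elements_mat (bcirc X) \<subseteq> stable_proper" if "X \<in> {A, B, C, D}" for X
    using assms that by (auto simp: RH_inf_tensor_iff)
  have len: "length A = p" using carrier_tensorD(1)[OF X(1)[of A]] by simp
  have c: "X ! k \<in> carrier_mat m m" if "X \<in> {A, B, C, D}" "k < p" for X k
    using carrier_tensorD(2)[OF X(1)[OF that(1)] that(2)] .
  have T: "tblock A B C D \<in> carrier_tensor (2 * m) (2 * m) p"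
    unfolding carrier_tensor_def tblock_def len mult_2 using c by auto
  moreover have "elements_mat (bcirc (tblock A B C D)) \<subseteq> stable_proper"
  proof (rule bcirc_elements[OF T p])
    fix k i j assume k: "k < p" and ij: "i < 2 * m" "j < 2 * m"
    have el: "(X ! k) $$ (i, j) \<in> stable_proper" if "X \<in> {A, B, C, D}" "i < m" "j < m" for X i j
      by (rule slice_in_stable_proper[OF X[OF that(1)] k that(2,3)])
    have dims: "dim_row (X ! k) = m" "dim_col (X ! k) = m" if "X \<in> {A, B, C, D}" for X
      using c[OF that k] by auto
    have "tblock A B C D ! k = four_block_mat (A ! k) (B ! k) (C ! k) (D ! k)"
      using k by (simp add: tblock_def len)
    then show "(tblock A B C D ! k) $$ (i, j) \<in> stable_proper"
      using ij by (simp add: dims el)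
  qed
  ultimately show ?thesis by (simp add: RH_inf_tensor_iff p)
qed

lemma tprod_in_RH_inf_tensor:
  assumes p: "0 < p" and "A \<in> RH_inf_tensor m p" "B \<in> RH_inf_tensor m p"
  shows "A \<star>\<^sub>T B \<in> RH_inf_tensor m p"
proof -
  interpret partial_ring_hom stable_proper rat_inf by (rule partial_ring_hom_rat_inf)
  have A: "A \<in> carrier_tensor m m p" "elements_mat (bcirc A) \<subseteq> stable_proper"
    and B: "B \<in> carrier_tensor m m p" "elements_mat (bcirc B) \<subseteq> stable_proper"
    using assms by (auto simp: RH_inf_tensor_iff)
  show ?thesis
    unfolding RH_inf_tensor_iff[OF p] bcirc_tprod[OF A(1) B(1) p]
    using tprod_carrier[OF A(1) B(1) p]
      mult_mat_in[OF bcirc_carrier[OF A(1) p] A(2) bcirc_carrier[OF B(1) p] B(2)] by blast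
qed

section \<open>Canonical phases of frequency responses\<close>

lemma freq_response_carrier: "G \<in> carrier_tensor m n p \<Longrightarrow> freq_response G \<omega> \<in> carrier_tensor m n p"
  by (auto simp: freq_response_def carrier_tensor_def subset_iff)

lemma bcirc_freq_response:
  assumes G: "G \<in> carrier_tensor m n p" and p: "0 < p"
  shows "bcirc (freq_response G \<omega>) = map_mat (\<lambda>r. rat_freq r \<omega>) (bcirc G)"
proof (rule eq_matI)
  note F = freq_response_carrier[OF G, of \<omega>]
  note c = bcirc_carrier[OF G p] bcirc_carrier[OF F p]
  show "dim_row (bcirc (freq_response G \<omega>)) = dim_row (map_mat (\<lambda>r. rat_freq r \<omega>) (bcirc G))"
    "dim_col (bcirc (freq_response G \<omega>)) = dim_col (map_mat (\<lambda>r. rat_freq r \<omega>) (bcirc G))" using c by auto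
  fix i j assume "i < dim_row (map_mat (\<lambda>r. rat_freq r \<omega>) (bcirc G))" "j < dim_col (map_mat (\<lambda>r. rat_freq r \<omega>) (bcirc G))"
  then have ij: "i < m * p" "j < n * p" using c by auto
  define k where "k = (i div m + (p - j div n)) mod p"
  have k: "k < p" using p by (simp add: k_def)
  show "bcirc (freq_response G \<omega>) $$ (i, j) = map_mat (\<lambda>r. rat_freq r \<omega>) (bcirc G) $$ (i, j)"
    using bcirc_index[OF F ij, folded k_def] bcirc_index[OF G ij, folded k_def] c ij k
      carrier_tensorD(1)[OF G] carrier_tensorD(2)[OF G k] block_index[OF ij(1)] block_index[OF ij(2)]
    by (simp add: freq_response_def)
qed

text \<open>Normalising \<open>x\<close> divides the value by the squared length, a positive factor.
  Statements about 0 and the negative real axis therefore pass from the numerical range to the form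
  on all nonzero vectors.\<close>

lemma sesq_scaled_in_numerical_range:
  assumes A: "bcirc A \<in> carrier_mat n n" and x: "x \<in> carrier_vec n" "x \<noteq> 0\<^sub>v n"
  shows "\<exists>r>0. \<exists>z \<in> numerical_range A. sesq (bcirc A) x x = of_real r * z"
proof -
  define s where "s = (\<Sum>i<n. (cmod (x $ i))\<^sup>2)"
  have "\<exists>i<n. x $ i \<noteq> 0"
  proof (rule ccontr)
    assume "\<not> (\<exists>i<n. x $ i \<noteq> 0)"
    then have "x = 0\<^sub>v n" using x(1) by (intro eq_vecI) auto
    then show False using x(2) by simp
  qed
  then obtain i where "i < n" "x $ i \<noteq> 0" by blast
  then have s: "0 < s" unfolding s_def by (intro sum_pos2[of _ i]) auto
  have xx: "scalar_prod (conjugate x) x = of_real s"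
    using x(1) unfolding scalar_prod_def s_def of_real_sum complex_norm_square
    by (auto simp: atLeast0LessThan mult.commute intro!: sum.cong)
  let ?y = "complex_of_real (1 / sqrt s) \<cdot>\<^sub>v x"
  have y: "?y \<in> carrier_vec n" using x by simp
  have ss: "complex_of_real (1 / sqrt s) * complex_of_real (1 / sqrt s) = of_real (1 / s)"
    using s unfolding of_real_mult[symmetric] by simp
  have "scalar_prod (conjugate ?y) ?y = cnj (of_real (1 / sqrt s)) * (of_real (1 / sqrt s) * scalar_prod (conjugate x) x)"
    using x(1) by (simp add: conjugate_smult_vec)
  also have "\<dots> = of_real (1 / s) * of_real s" unfolding xx using ss by (simp only: complex_cnj_complex_of_real mult.assoc[symmetric])
  finally have y1: "scalar_prod (conjugate ?y) ?y = 1" using s by simp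
  have "sesq (bcirc A) ?y ?y = of_real (1 / s) * sesq (bcirc A) x x"
    unfolding sesq_smult_right[OF A y x(1)] sesq_smult_left[OF A x(1) x(1)]
    using ss by (simp only: complex_cnj_complex_of_real mult.assoc[symmetric])
  then have "sesq (bcirc A) x x = of_real s * sesq (bcirc A) ?y ?y" using s by simp
  moreover have "sesq (bcirc A) ?y ?y \<in> numerical_range A"
    unfolding numerical_range_def sesq_def using y y1 A by blast
  ultimately show ?thesis using s by blast
qed

lemma sectorial_imp_anisotropic:
  assumes "bcirc A \<in> carrier_mat n n" "sectorial A"
  shows "anisotropic (bcirc A)"
  unfolding anisotropic_def
proof (intro ballI impI)
  fix x :: "complex vec" assume "x \<in> carrier_vec (dim_row (bcirc A))" "x \<noteq> 0\<^sub>v (dim_row (bcirc A))"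
  then obtain r z where "0 < r" "z \<in> numerical_range A" "sesq (bcirc A) x x = of_real r * z"
    using sesq_scaled_in_numerical_range[OF assms(1), of x] assms(1) by auto
  then show "sesq (bcirc A) x x \<noteq> 0" using assms(2) by (auto simp: sectorial_def)
qed

lemma sesq_avoids_negative_axis:
  assumes A: "bcirc A \<in> carrier_mat n n" and W: "numerical_range A \<inter> negative_real_axis = {}"
    and x: "x \<in> carrier_vec n"
  shows "sesq (bcirc A) x x \<notin> negative_real_axis"
proof (cases "x = 0\<^sub>v n")
  case True
  then show ?thesis using A by (simp add: negative_real_axis_def)
next
  case False
  obtain r z where r: "0 < r" "z \<in> numerical_range A" "sesq (bcirc A) x x = of_real r * z"
    using sesq_scaled_in_numerical_range[OF A x False] by blast
  then have "z \<notin> negative_real_axis" using W by blast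
  then show ?thesis using r(1) unfolding r(3) by (auto simp: negative_real_axis_def mult_less_0_iff)
qed

text \<open>Justifies the choice in \<open>tphases\<close> at each frequency. At finite frequencies
  the axis hypothesis applies directly; at infinity it is available only for the approximating
  values, and the limit matrix is real because proper real-rational functions have real
  limits.\<close>

lemma canonical_phases_freq_response:
  assumes m: "0 < m" and p: "0 < p" and G: "G \<in> RH_inf_tensor m p"
    and sec: "\<And>\<omega>. 0 \<le> \<omega> \<Longrightarrow> sectorial (freq_response G \<omega>)"
    and neg: "\<And>w :: real. numerical_range (freq_response G (ereal w)) \<inter> negative_real_axis = {}"
    and \<omega>: "0 \<le> \<omega>"
  shows "canonical_phases (freq_response G \<omega>) (tphases (freq_response G \<omega>))"
proof -
  have Gc: "G \<in> carrier_tensor m m p" and el: "elements_mat (bcirc G) \<subseteq> stable_proper"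
    using G by (auto simp: RH_inf_tensor_iff p)
  let ?n = "m * p" and ?F = "freq_response G"
  have n: "0 < ?n" using m p by simp
  have c: "bcirc (?F w) \<in> carrier_mat ?n ?n" for w
    by (rule bcirc_carrier[OF freq_response_carrier[OF Gc] p])
  have an: "anisotropic (bcirc (?F w))" if "0 \<le> w" for w
    by (rule sectorial_imp_anisotropic[OF c sec[OF that]])
  have "\<exists>\<phi>. canonical_phases (?F \<omega>) \<phi>"
  proof (cases \<omega>)
    case (real w)
    show ?thesis
      unfolding real using an[OF \<omega>] unfolding real
      by (rule canonical_phases_exist[OF c n _ sesq_avoids_negative_axis[OF c neg]])
  next
    case PInf
    have sp: "bcirc G $$ (i, j) \<in> stable_proper" if "i < ?n" "j < ?n" for i j
      by (rule elements_mat_subsetD[OF bcirc_carrier[OF Gc p] el that])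
    have val: "bcirc (?F w) $$ (i, j) = rat_freq (bcirc G $$ (i, j)) w" if "i < ?n" "j < ?n" for i j w
      unfolding bcirc_freq_response[OF Gc p] using that bcirc_carrier[OF Gc p] by simp
    show ?thesis unfolding PInf
    proof (rule canonical_phases_exist_limit[OF c n an, where F = at_top and B = "\<lambda>w :: real. bcirc (?F (ereal w))"])
      fix i j assume ij: "i < ?n" "j < ?n"
      show "bcirc (?F \<infinity>) $$ (i, j) \<in> \<real>"
        unfolding val[OF ij] rat_freq_infinity[OF sp[OF ij]] by (rule rat_inf_real[OF sp[OF ij]])
      show "((\<lambda>w. bcirc (?F (ereal w)) $$ (i, j)) \<longlongrightarrow> bcirc (?F \<infinity>) $$ (i, j)) at_top"
        unfolding val[OF ij] rat_freq_infinity[OF sp[OF ij]] by (rule tendsto_rat_freq[OF sp[OF ij]])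
    next
      show "\<forall>\<^sub>F w in at_top. anisotropic (bcirc (?F (ereal w)))"
        using eventually_ge_at_top[of "0 :: real"] by eventually_elim (simp add: an)
      show "\<forall>\<^sub>F w in at_top. \<forall>x \<in> carrier_vec ?n. sesq (bcirc (?F (ereal w))) x x \<notin> negative_real_axis"
        using sesq_avoids_negative_axis[OF c neg] by simp
    qed (simp_all add: c)
  next
    case MInf
    then show ?thesis using \<omega> by simp
  qed
  then show ?thesis unfolding tphases_def by (rule someI_ex)
qed

theorem theorem5p4:
  fixes m p :: nat and G H :: "real poly fract tensor"
  assumes "m \<ge> 1" and "p \<ge> 1"
    and "G \<in> RH_inf_tensor m p" and "H \<in> RH_inf_tensor m p"
    and "frequency_wise quasi_sectorial G"
    and "frequency_wise semi_sectorial H"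
    and "\<And>\<omega> :: real. numerical_range (freq_response G (ereal \<omega>)) \<inter> negative_real_axis = {}"
    and "\<And>\<omega> :: real. numerical_range (freq_response H (ereal \<omega>)) \<inter> negative_real_axis = {}"
    and "\<And>\<omega> :: ereal. 0 \<le> \<omega> \<Longrightarrow>
      phase_max (freq_response G \<omega>) + phase_max (freq_response H \<omega>) < pi"
    and "\<And>\<omega> :: ereal. 0 \<le> \<omega> \<Longrightarrow>
      phase_min (freq_response G \<omega>) + phase_min (freq_response H \<omega>) > - pi"
  shows "feedback_stable m p G H"
proof -
  have m: "0 < m" and p: "0 < p" using assms(1,2) by simp_all
  let ?n = "m * p"
  have G: "G \<in> carrier_tensor m m p" "elements_mat (bcirc G) \<subseteq> stable_proper"
    and H: "H \<in> carrier_tensor m m p" "elements_mat (bcirc H) \<subseteq> stable_proper"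
    using assms(3,4) by (auto simp: RH_inf_tensor_iff p)
  note cG = bcirc_carrier[OF G(1) p] and cH = bcirc_carrier[OF H(1) p]
  interpret partial_ring_hom stable_proper rat_inf by (rule partial_ring_hom_rat_inf)
  define P where "P = bcirc H * bcirc G"
  have P: "P \<in> carrier_mat ?n ?n" "elements_mat P \<subseteq> stable_proper"
    using mult_mat_in[OF cH H(2) cG G(2)] cG cH by (auto simp: P_def)
  have polG: "\<exists>r \<alpha>. 0 < r \<and> phase_min (freq_response G \<omega>) \<le> \<alpha> \<and> \<alpha> \<le> phase_max (freq_response G \<omega>) \<and>
      sesq (bcirc (freq_response G \<omega>)) x x = of_real r * cis \<alpha>"
    if "0 \<le> \<omega>" "x \<in> carrier_vec ?n" "x \<noteq> 0\<^sub>v ?n" for \<omega> x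
  proof -
    have "sectorial (freq_response G \<omega>)" if "0 \<le> \<omega>" for \<omega>
      using assms(5) that by (auto simp: frequency_wise_def quasi_sectorial_def phase_class_def)
    from canonical_phases_freq_response[OF m p assms(3) this assms(7) that(1)]
    show ?thesis unfolding phase_min_def phase_max_def
      by (rule canonical_phases_polar[OF _ bcirc_carrier[OF freq_response_carrier[OF G(1)] p] that(2,3)])
  qed
  have polH: "\<exists>r \<alpha>. 0 < r \<and> phase_min (freq_response H \<omega>) \<le> \<alpha> \<and> \<alpha> \<le> phase_max (freq_response H \<omega>) \<and>
      sesq (bcirc (freq_response H \<omega>)) x x = of_real r * cis \<alpha>"
    if "0 \<le> \<omega>" "x \<in> carrier_vec ?n" "x \<noteq> 0\<^sub>v ?n" for \<omega> x
  proof -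
    have "sectorial (freq_response H \<omega>)" if "0 \<le> \<omega>" for \<omega>
      using assms(6) that by (auto simp: frequency_wise_def semi_sectorial_def phase_class_def)
    from canonical_phases_freq_response[OF m p assms(4) this assms(8) that(1)]
    show ?thesis unfolding phase_min_def phase_max_def
      by (rule canonical_phases_polar[OF _ bcirc_carrier[OF freq_response_carrier[OF H(1)] p] that(2,3)])
  qed
  have nz: "det (1\<^sub>m ?n + complex_of_real t \<cdot>\<^sub>m map_mat (\<lambda>r. rat_freq r \<omega>) P) \<noteq> 0"
    if t: "t \<in> {0..1}" and \<omega>: "0 \<le> \<omega>" for t \<omega>
  proof -
    \<comment> \<open>At each frequency, infinity included, evaluation is a homomorphism on the
      entries, so the evaluated product is the product of the two frequency responses.\<close>
    have "partial_ring_hom stable_proper (\<lambda>r. rat_freq r \<omega>)"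
    proof (cases \<omega>)
      case (real w)
      show ?thesis unfolding real rat_freq_real by (rule partial_ring_hom_rat_value) simp
    next
      case PInf
      show ?thesis unfolding PInf
        using partial_ring_hom_rat_inf unfolding partial_ring_hom_def
        by (simp add: rat_freq_infinity)
    qed (use \<omega> in simp)
    then interpret h: partial_ring_hom stable_proper "\<lambda>r. rat_freq r \<omega>" .
    have "map_mat (\<lambda>r. rat_freq r \<omega>) P = bcirc (freq_response H \<omega>) * bcirc (freq_response G \<omega>)"
      unfolding P_def h.h_mult_mat[OF cH H(2) cG G(2)] bcirc_freq_response[OF G(1) p] bcirc_freq_response[OF H(1) p] ..
    then show ?thesis
      using det_one_plus_product_nonzero[OF bcirc_carrier[OF freq_response_carrier[OF G(1)] p]
          bcirc_carrier[OF freq_response_carrier[OF H(1)] p] polG[OF \<omega>] polH[OF \<omega>] assms(9)[OF \<omega>] assms(10)[OF \<omega>], of t] t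
      by simp
  qed
  let ?R = "return_difference m p G H"
  have R: "?R \<in> carrier_tensor m m p"
    unfolding return_difference_def by (rule tplus_carrier[OF tid_carrier tprod_carrier[OF H(1) G(1) p]])
  \<comment> \<open>Under \<open>bcirc\<close> the return difference becomes the matrix to which the
    unit criterion for the determinant applies.\<close>
  have bR: "bcirc ?R = 1\<^sub>m ?n + P"
    unfolding return_difference_def P_def bcirc_tplus[OF tid_carrier tprod_carrier[OF H(1) G(1) p] p]
      bcirc_tprod[OF H(1) G(1) p] bcirc_tid[OF m p] ..
  note unit = det_return_difference_unit[OF P nz]
  have IP: "1\<^sub>m ?n + P \<in> carrier_mat ?n ?n" "elements_mat (1\<^sub>m ?n + P) \<subseteq> stable_proper"
    using P add_mat_in[OF one_carrier_mat one_mat_in P] by auto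
  obtain X where X: "X \<in> carrier_mat ?n ?n" "elements_mat X \<subseteq> stable_proper"
    "(1\<^sub>m ?n + P) * X = 1\<^sub>m ?n" "X * (1\<^sub>m ?n + P) = 1\<^sub>m ?n"
    using inverse_mat_in[OF IP unit(2)] unit(1) by auto
  obtain S where S: "is_tinverse ?R S" "bcirc S = X"
    using is_tinverse_exists[OF R m p X(1)] X(3,4) unfolding bR by blast
  have "S \<in> RH_inf_tensor m p"
    using S X(2) is_tinverse_iff[OF R m p] by (auto simp: RH_inf_tensor_iff[OF p])
  \<comment> \<open>Each block is a product of factors among \<open>S\<close>, \<open>G\<close> and
    \<open>H\<close>, so closure under the T-product settles it.\<close>
  then have "feedback m p G H \<in> RH_inf_tensor (2 * m) p"
    unfolding feedback_def Let_def tinv_eqI[OF R m p S(1)]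
    by (intro tblock_in_RH_inf_tensor tprod_in_RH_inf_tensor p assms(3,4))
  then show ?thesis using S(1) by (auto simp: feedback_stable_def tinvertible_def)
qed

end
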